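(* Let $A=T/\langle r_1,\ldots,r_m\rangle$ be a graded $K$-algebra, let $U=T/\langle r_1+l_1,\ldots,r_m+l_m\rangle$ be a deformation of $A$, and let $D$ be the central extension of $A$ associated to $U$. Then $U$ is a PBW-deformation of $A$ if and only if $D$ is a regular central extension of $A$.
   Context: $K$ is a field and $T=K\langle x_1,\ldots,x_n\rangle$ is the free algebra with its standard grading ($\deg x_i=1$) and standard filtration $F^kT=\bigoplus_{i\le k}T_i$. A graded $K$-algebra is $A=T/\langle r_1,\ldots,r_m\rangle$, where $r_1,\ldots,r_m$ are homogeneous elements of $T$ of degree at least $2$ (no linear relations) forming a minimal set of relations for $A$; $A$ inherits the grading of $T$. A deformation of $A$ is an algebra $U=T/\langle r_1+l_1,\ldots,r_m+l_m\rangle$ where $l_1,\ldots,l_m\in T$ are (not necessarily homogeneous) elements with $\deg(l_i)<\deg(r_i)$ for all $i$. $U$ inherits a filtration $F^k(U)$ (the image of $F^kT$), and its associated graded algebra is $gr(U)=\bigoplus_k gr(U)_k$ with $gr(U)_k=F^k(U)/F^{k-1}(U)$. The deformation $U$ is a PBW-deformation of $A$ if $gr(U)$ is isomorphic to $A$ (as a graded $K$-algebra). Let $T[z]=T\otimes_K K[z]$, graded with $\deg z=1$. For $f=\sum_{i=0}^p f_i\in T$ with $f_i\in T_i$, $f_p\neq 0$, the homogenization of $f$ is $h(f)=\sum_{i=0}^p z^{p-i}f_i\in T[z]$. The central extension of $A$ associated to $U$ is the graded algebra $D=T[z]/\langle h(r_1+l_1),\ldots,h(r_m+l_m)\rangle$.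 It is a regular central extension if the (central) element $z\in D$ is not a zero divisor in $D$. *)

theory Defs
  imports "HOL-Algebra.Module" "HOL-Algebra.QuotRing" "HOL-Algebra.Product_Groups" "HOL-Library.Poly_Mapping"
begin

text \<open>
  The ground field \<open>K\<close> is a type \<^typ>\<open>'k\<close> of class \<^class>\<open>field\<close>. A (not necessarily commutative)
  \<open>K\<close>-algebra is a ring of HOL-Algebra with a scalar multiplication, that is, a record of type
  \<open>('k, 'a) module\<close>. (The locale \<open>algebra\<close> of HOL-Algebra is restricted to commutative algebras.)
\<close>

text \<open>Scalar multiplication of the class \<open>X\<close> modulo the additive subgroup \<open>H\<close>.\<close>

definition coset_smult :: "('k, 'a) module \<Rightarrow> 'a set \<Rightarrow> 'k \<Rightarrow> 'a set \<Rightarrow> 'a set"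
  where "coset_smult M H c X = (\<Union>x\<in>X. H +>\<^bsub>M\<^esub> (c \<odot>\<^bsub>M\<^esub> x))"

definition quot_alg :: "('k, 'a) module \<Rightarrow> 'a set \<Rightarrow> ('k, 'a set) module"
  where "quot_alg M I =
    \<lparr>carrier = carrier (M Quot I), monoid.mult = monoid.mult (M Quot I), one = one (M Quot I),
     zero = zero (M Quot I), add = add (M Quot I), smult = coset_smult M I\<rparr>"

text \<open>
  The grading or filtration that a quotient inherits: the images of the members of the given
  family of subsets.
\<close>

definition quot_family :: "('k, 'a) module \<Rightarrow> 'a set \<Rightarrow> (nat \<Rightarrow> 'a set) \<Rightarrow> nat \<Rightarrow> 'a set set"
  where "quot_family M I P k = a_r_coset M I ` P k"

definition graded_alg_isomorphic ::
    "('k, 'a) module \<Rightarrow> (nat \<Rightarrow> 'a set) \<Rightarrow> ('k, 'b) module \<Rightarrow> (nat \<Rightarrow> 'b set) \<Rightarrow> bool"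
  where "graded_alg_isomorphic A P B Q \<longleftrightarrow>
    (\<exists>\<phi> \<in> ring_iso A B.
      (\<forall>c. \<forall>x \<in> carrier A. \<phi> (c \<odot>\<^bsub>A\<^esub> x) = c \<odot>\<^bsub>B\<^esub> \<phi> x) \<and>
      (\<forall>k. \<phi> ` P k = Q k))"

definition zero_divisor :: "('a, 'b) ring_scheme \<Rightarrow> 'a \<Rightarrow> bool"
  where "zero_divisor R a \<longleftrightarrow>
    (\<exists>b \<in> carrier R. b \<noteq> \<zero>\<^bsub>R\<^esub> \<and> (a \<otimes>\<^bsub>R\<^esub> b = \<zero>\<^bsub>R\<^esub> \<or> b \<otimes>\<^bsub>R\<^esub> a = \<zero>\<^bsub>R\<^esub>))"

text \<open>\<open>F\<^sup>k\<^sup>-\<^sup>1\<close>, with the convention that \<open>F\<^sup>-\<^sup>1 = 0\<close>.\<close>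

definition filt_prev :: "('k, 'a) module \<Rightarrow> (nat \<Rightarrow> 'a set) \<Rightarrow> nat \<Rightarrow> 'a set"
  where "filt_prev U F k = (case k of 0 \<Rightarrow> {\<zero>\<^bsub>U\<^esub>} | Suc j \<Rightarrow> F j)"

text \<open>The additive group \<open>F\<^sup>k / F\<^sup>k\<^sup>-\<^sup>1\<close>, written as a HOL-Algebra quotient group.\<close>

definition gr_comp :: "('k, 'a) module \<Rightarrow> (nat \<Rightarrow> 'a set) \<Rightarrow> nat \<Rightarrow> 'a set monoid"
  where "gr_comp U F k = add_monoid (U\<lparr>carrier := F k\<rparr>) Mod filt_prev U F k"

text \<open>
  The direct sum of the groups \<open>F\<^sup>k / F\<^sup>k\<^sup>-\<^sup>1\<close>; its elements are the finitely supported families of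
  classes. The product is determined by
  \<open>(a + F\<^sup>i\<^sup>-\<^sup>1) (b + F\<^sup>j\<^sup>-\<^sup>1) = a b + F\<^sup>i\<^sup>+\<^sup>j\<^sup>-\<^sup>1\<close>, which is the set \<^const>\<open>rcoset_mult\<close> formed with
  \<open>F\<^sup>i\<^sup>+\<^sup>j\<^sup>-\<^sup>1\<close>. The group operation of \<^const>\<open>gr_comp\<close> is addition, so \<^const>\<open>finprod\<close> is a sum here.
\<close>

definition gr_alg :: "('k, 'a) module \<Rightarrow> (nat \<Rightarrow> 'a set) \<Rightarrow> ('k, nat \<Rightarrow> 'a set) module"
  where "gr_alg U F =
    \<lparr>carrier = carrier (sum_group UNIV (gr_comp U F)),
     monoid.mult = (\<lambda>f g k. finprod (gr_comp U F k)
       (\<lambda>i. rcoset_mult U (filt_prev U F k) (f i) (g (k - i))) {..k}),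
     one = (\<lambda>k. if k = 0 then filt_prev U F 0 +>\<^bsub>U\<^esub> \<one>\<^bsub>U\<^esub> else filt_prev U F k),
     zero = one (sum_group UNIV (gr_comp U F)),
     add = monoid.mult (sum_group UNIV (gr_comp U F)),
     smult = (\<lambda>c f k. coset_smult U (filt_prev U F k) c (f k))\<rparr>"

definition gr_part :: "('k, 'a) module \<Rightarrow> (nat \<Rightarrow> 'a set) \<Rightarrow> nat \<Rightarrow> (nat \<Rightarrow> 'a set) set"
  where "gr_part U F k = {f \<in> carrier (gr_alg U F). \<forall>i. i \<noteq> k \<longrightarrow> f i = filt_prev U F i}"

text \<open>
  Words form the free monoid under concatenation. With this instance the convolution product of
  \<^typ>\<open>'x list \<Rightarrow>\<^sub>0 'k\<close> is the product of the free algebra on the letters \<^typ>\<open>'x\<close>.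
\<close>

instantiation list :: (type) monoid_add
begin

definition zero_list :: "'a list" where "zero_list = []"

definition plus_list :: "'a list \<Rightarrow> 'a list \<Rightarrow> 'a list" where "plus_list = (@)"

instance by standard (simp_all add: zero_list_def plus_list_def)

end

type_synonym ('x, 'k) ncpoly = "'x list \<Rightarrow>\<^sub>0 'k"

definition free_alg :: "('k::field, ('x, 'k) ncpoly) module"
  where "free_alg =
    \<lparr>carrier = UNIV, monoid.mult = (*), one = 1, zero = 0, add = (+),
     smult = (\<lambda>c f. Poly_Mapping.single 0 c * f)\<rparr>"

definition free_part :: "nat \<Rightarrow> ('x, 'k::field) ncpoly set"
  where "free_part k = {f. \<forall>w \<in> Poly_Mapping.keys f. length w = k}"

definition free_filt :: "nat \<Rightarrow> ('x, 'k::field) ncpoly set"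
  where "free_filt k = {\<Sum>i\<le>k. f i |f. \<forall>i\<le>k. f i \<in> free_part i}"

definition hom_comp :: "nat \<Rightarrow> ('x, 'k::field) ncpoly \<Rightarrow> ('x, 'k) ncpoly"
  where "hom_comp i f =
    (\<Sum>w \<in> {w \<in> Poly_Mapping.keys f. length w = i}. Poly_Mapping.single w (Poly_Mapping.lookup f w))"

text \<open>
  The zero element gets degree \<open>0\<close> instead of \<open>-\<infinity>\<close>. Degrees are only compared with
  degrees of relations, which are at least \<open>2\<close>.
\<close>

definition ncdeg :: "('x, 'k::field) ncpoly \<Rightarrow> nat"
  where "ncdeg f = Max (insert 0 (length ` Poly_Mapping.keys f))"

text \<open>
  An element of \<open>T[z]\<close> is a polynomial \<open>\<Sum>j. z\<^sup>j a\<^sub>j\<close>, stored as the map \<open>j \<mapsto> a\<^sub>j\<close> into the free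
  algebra; under the convolution product \<open>z\<close> commutes with the coefficients.
\<close>

definition free_alg_z :: "('k::field, nat \<Rightarrow>\<^sub>0 ('x, 'k) ncpoly) module"
  where "free_alg_z =
    \<lparr>carrier = UNIV, monoid.mult = (*), one = 1, zero = 0, add = (+),
     smult = (\<lambda>c f. Poly_Mapping.single 0 (Poly_Mapping.single 0 c) * f)\<rparr>"

lemma ring_free_alg: "ring free_alg"
  by (rule ringI; (rule abelian_groupI monoidI)?)
     (auto simp: free_alg_def algebra_simps intro: exI[of _ "- x" for x])

lemma ring_free_alg_z: "ring free_alg_z"
  by (rule ringI; (rule abelian_groupI monoidI)?)
     (auto simp: free_alg_z_def algebra_simps intro: exI[of _ "- x" for x])

definition var_z :: "nat \<Rightarrow>\<^sub>0 ('x, 'k::field) ncpoly"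
  where "var_z = Poly_Mapping.single 1 1"

lemma var_z_central: "var_z * f = f * var_z"
proof (induction f rule: update_induct)
  case const
  then show ?case by simp
next
  case (update f a b)
  have "Poly_Mapping.update a b f = f + Poly_Mapping.single a b"
    using update.hyps(1)
    by (intro poly_mapping_eqI) (auto simp: Poly_Mapping.update.rep_eq lookup_add lookup_single in_keys_iff when_def)
  with update.IH show ?case
    by (simp add: algebra_simps) (simp add: var_z_def mult_single add.commute)
qed

definition homogenize :: "('x, 'k::field) ncpoly \<Rightarrow> (nat \<Rightarrow>\<^sub>0 ('x, 'k) ncpoly)"
  where "homogenize f = (\<Sum>i\<le>ncdeg f. Poly_Mapping.single (ncdeg f - i) (hom_comp i f))"

text \<open>Families of \<open>m\<close> relations are indexed by \<open>0, \<dots>, m - 1\<close>.\<close>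

definition rel_ideal :: "nat \<Rightarrow> (nat \<Rightarrow> ('x, 'k::field) ncpoly) \<Rightarrow> ('x, 'k) ncpoly set"
  where "rel_ideal m s = Idl\<^bsub>free_alg\<^esub> (s ` {..<m})"

definition pres_alg :: "nat \<Rightarrow> (nat \<Rightarrow> ('x, 'k::field) ncpoly) \<Rightarrow> ('k, ('x, 'k) ncpoly set) module"
  where "pres_alg m s = quot_alg free_alg (rel_ideal m s)"

definition pres_part :: "nat \<Rightarrow> (nat \<Rightarrow> ('x, 'k::field) ncpoly) \<Rightarrow> nat \<Rightarrow> ('x, 'k) ncpoly set set"
  where "pres_part m s = quot_family free_alg (rel_ideal m s) free_part"

definition pres_filt :: "nat \<Rightarrow> (nat \<Rightarrow> ('x, 'k::field) ncpoly) \<Rightarrow> nat \<Rightarrow> ('x, 'k) ncpoly set set"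
  where "pres_filt m s = quot_family free_alg (rel_ideal m s) free_filt"

text \<open>
  Minimality: no proper subfamily generates the same ideal. In particular the relations are
  nonzero and pairwise distinct.
\<close>

definition graded_relations :: "nat \<Rightarrow> (nat \<Rightarrow> ('x, 'k::field) ncpoly) \<Rightarrow> bool"
  where "graded_relations m r \<longleftrightarrow>
    (\<forall>i<m. \<exists>d\<ge>2. r i \<in> free_part d) \<and>
    (\<forall>J. J \<subset> {..<m} \<longrightarrow> Idl\<^bsub>free_alg\<^esub> (r ` J) \<noteq> rel_ideal m r)"

definition deformation_terms ::
    "nat \<Rightarrow> (nat \<Rightarrow> ('x, 'k::field) ncpoly) \<Rightarrow> (nat \<Rightarrow> ('x, 'k) ncpoly) \<Rightarrow> bool"
  where "deformation_terms m r l \<longleftrightarrow> (\<forall>i<m. ncdeg (l i) < ncdeg (r i))"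

definition PBW_deformation ::
    "nat \<Rightarrow> (nat \<Rightarrow> ('x, 'k::field) ncpoly) \<Rightarrow> (nat \<Rightarrow> ('x, 'k) ncpoly) \<Rightarrow> bool"
  where "PBW_deformation m r l \<longleftrightarrow>
    (let U = pres_alg m (\<lambda>i. r i + l i); F = pres_filt m (\<lambda>i. r i + l i)
     in graded_alg_isomorphic (gr_alg U F) (gr_part U F) (pres_alg m r) (pres_part m r))"

definition ext_ideal ::
    "nat \<Rightarrow> (nat \<Rightarrow> ('x, 'k::field) ncpoly) \<Rightarrow> (nat \<Rightarrow> ('x, 'k) ncpoly) \<Rightarrow> (nat \<Rightarrow>\<^sub>0 ('x, 'k) ncpoly) set"
  where "ext_ideal m r l = Idl\<^bsub>free_alg_z\<^esub> ((\<lambda>i. homogenize (r i + l i)) ` {..<m})"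

definition central_ext ::
    "nat \<Rightarrow> (nat \<Rightarrow> ('x, 'k::field) ncpoly) \<Rightarrow> (nat \<Rightarrow> ('x, 'k) ncpoly) \<Rightarrow>
     ('k, (nat \<Rightarrow>\<^sub>0 ('x, 'k) ncpoly) set) module"
  where "central_ext m r l = quot_alg free_alg_z (ext_ideal m r l)"

definition regular_central_extension ::
    "nat \<Rightarrow> (nat \<Rightarrow> ('x, 'k::field) ncpoly) \<Rightarrow> (nat \<Rightarrow> ('x, 'k) ncpoly) \<Rightarrow> bool"
  where "regular_central_extension m r l \<longleftrightarrow>
    \<not> zero_divisor (central_ext m r l) (ext_ideal m r l +>\<^bsub>free_alg_z\<^esub> var_z)"

end

theory Submission
  imports Defs HOL.Vector_Spaces
begin

text \<open>
  Write \<open>I\<close>, \<open>J\<close> and \<open>H\<close> for the ideals of the relations \<open>r\<^sub>i\<close>, \<open>r\<^sub>i + l\<^sub>i\<close> and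
  \<open>h(r\<^sub>i + l\<^sub>i)\<close>, so that \<open>A = T/I\<close>, \<open>U = T/J\<close> and \<open>D = T[z]/H\<close>. Both properties are shown
  to be equivalent to one statement about leading forms:
  whenever \<open>f\<close> is homogeneous of degree \<open>k\<close> and \<open>f + g \<in> J\<close> for some \<open>g\<close> of smaller degree, then
  \<open>f \<in> I\<close>.

  Regularity: the ring homomorphisms \<open>z \<mapsto> 0\<close> and \<open>z \<mapsto> 1\<close> map \<open>H\<close> onto \<open>I\<close> and onto \<open>J\<close>
  (\<open>I_eq\<close>, \<open>J_eq\<close>), and \<open>H\<close> is homogeneous for the total degree (\<open>tot_comp_in_H\<close>). An element of
  \<open>T[z]\<close> that is homogeneous of degree \<open>n\<close> is the homogenization, to degree \<open>n\<close>, of its image under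
  \<open>z \<mapsto> 1\<close>.
  If \<open>f + g \<in> J\<close>, then lifting \<open>f + g\<close> to \<open>H\<close> and bringing the components of the lift to a common degree
  shows that \<open>z\<^sup>e h(f + g) \<in> H\<close> for some \<open>e\<close>; if \<open>z\<close> is regular, then \<open>h(f + g) \<in> H\<close>, and \<open>z \<mapsto> 0\<close>
  gives \<open>f \<in> I\<close>. Conversely, suppose that the leading forms of \<open>J\<close> lie in \<open>I\<close>, and let \<open>u \<in> J\<close> have
  degree at most \<open>n\<close>. Its component of degree \<open>n\<close> is also that of the image under \<open>z \<mapsto> 1\<close> of some
  element of \<open>H\<close> that is homogeneous of degree \<open>n\<close>. Subtracting this image and recursing on \<open>n\<close> shows
  that the homogenization of \<open>u\<close> to degree \<open>n\<close> lies in \<open>H\<close> (\<open>homogenize_to_in_H\<close>).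
  If \<open>z g \<in> H\<close>, this applies to the image under \<open>z \<mapsto> 1\<close> of each homogeneous component of \<open>g\<close>.

  PBW property: sending \<open>f\<close> to the family of classes of its homogeneous components is a
  surjective graded homomorphism from \<open>T\<close> to \<open>gr(U)\<close>, called \<open>symbol\<close> below, whose kernel in degree
  \<open>k\<close> consists of the leading forms of degree \<open>k\<close> of \<open>J\<close>. This kernel always contains \<open>I\<close>. If it
  equals \<open>I\<close>, then \<open>gr(U)\<close> and \<open>A\<close> are isomorphic (\<open>leading_forms_imp_PBW\<close>). For the converse, an
  isomorphism of \<open>gr(U)\<close> with \<open>A\<close> may be unrelated to \<open>symbol\<close>, but it forces the degree \<open>k\<close>
  parts of the two kernels to have the same codimension in the finite-dimensional space \<open>T\<^sub>k\<close>, and one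
  kernel contains the other (\<open>PBW_imp_leading_forms\<close>).
\<close>

section \<open>Additive induction on monomials\<close>

text \<open>
  The identities for products, components and specializations below are between maps that are
  additive in each argument. These two rules reduce them to monomials.
\<close>

lemma poly_mapping_additive_induct [case_names single add]:
  fixes f :: "'a \<Rightarrow>\<^sub>0 'b::comm_monoid_add"
  assumes single: "\<And>a b. P (Poly_Mapping.single a b)"
    and add: "\<And>f g. P f \<Longrightarrow> P g \<Longrightarrow> P (f + g)"
  shows "P f"
proof (induction f rule: update_induct)
  case const
  then show ?case using single[of undefined 0] by simp
next
  case (update f a b)
  have "Poly_Mapping.update a b f = f + Poly_Mapping.single a b"
    using update.hyps(1)
    by (intro poly_mapping_eqI)
      (auto simp: Poly_Mapping.update.rep_eq lookup_add lookup_single in_keys_iff when_def)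
  then show ?case using add[OF update.IH single] by simp
qed

lemma monomial_induct [case_names monomial add]:
  fixes q :: "nat \<Rightarrow>\<^sub>0 ('x, 'k::field) ncpoly"
  assumes monomial: "\<And>j w c. P (Poly_Mapping.single j (Poly_Mapping.single w c))"
    and add: "\<And>f g. P f \<Longrightarrow> P g \<Longrightarrow> P (f + g)"
  shows "P q"
proof (induction q rule: poly_mapping_additive_induct)
  case (single j f)
  show ?case
    by (induction f rule: poly_mapping_additive_induct) (auto simp: single_add intro: monomial add)
qed (rule add)

lemma length_plus_list [simp]: "length (v + w) = length v + length w"
  by (simp add: plus_list_def)

lemma length_zero_list [simp]: "length 0 = 0"
  by (simp add: zero_list_def)

section \<open>Homogeneous components in the free algebra\<close>

lemma lookup_hom_comp: "Poly_Mapping.lookup (hom_comp i f) w = (if length w = i then Poly_Mapping.lookup f w else 0)"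
proof -
  have "Poly_Mapping.lookup (hom_comp i f) w
      = (\<Sum>v \<in> {v \<in> Poly_Mapping.keys f. length v = i}. if v = w then Poly_Mapping.lookup f v else 0)"
    by (simp add: hom_comp_def lookup_sum lookup_single when_def)
  also have "\<dots> = (if w \<in> {v \<in> Poly_Mapping.keys f. length v = i} then Poly_Mapping.lookup f w else 0)"
    by (subst sum.delta) auto
  finally show ?thesis by (auto simp: in_keys_iff)
qed

lemma hom_comp_add: "hom_comp i (f + g) = hom_comp i f + hom_comp i g"
  by (rule poly_mapping_eqI) (simp add: lookup_hom_comp lookup_add)

lemma hom_comp_0 [simp]: "hom_comp i 0 = 0"
  by (rule poly_mapping_eqI) (simp add: lookup_hom_comp)

lemma hom_comp_uminus: "hom_comp i (- f) = - hom_comp i f"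
  by (rule poly_mapping_eqI) (simp add: lookup_hom_comp)

lemma hom_comp_diff: "hom_comp i (f - g) = hom_comp i f - hom_comp i g"
  by (rule poly_mapping_eqI) (simp add: lookup_hom_comp lookup_minus)

lemma hom_comp_sum: "hom_comp i (sum f A) = (\<Sum>a\<in>A. hom_comp i (f a))"
  by (induction A rule: infinite_finite_induct) (simp_all add: hom_comp_add)

lemma hom_comp_single:
  "hom_comp i (Poly_Mapping.single w c) = (if length w = i then Poly_Mapping.single w c else 0)"
  by (rule poly_mapping_eqI) (simp add: lookup_hom_comp lookup_single when_def)

lemma hom_comp_hom_comp: "hom_comp i (hom_comp j f) = (if i = j then hom_comp j f else 0)"
  by (rule poly_mapping_eqI) (simp add: lookup_hom_comp)

lemma hom_comp_1: "hom_comp i 1 = (if i = 0 then 1 else 0)"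
  unfolding single_one[symmetric] hom_comp_single by auto

lemma hom_comp_mult:
  "hom_comp k (f * g) = (\<Sum>i\<le>k. hom_comp i f * hom_comp (k - i) g)"
proof (induction f rule: poly_mapping_additive_induct)
  case (single v a)
  show ?case
  proof (induction g rule: poly_mapping_additive_induct)
    case (single w b)
    have "(\<Sum>i\<le>k. hom_comp i (Poly_Mapping.single v a) * hom_comp (k - i) (Poly_Mapping.single w b))
        = (\<Sum>i\<le>k. if i = length v then
            Poly_Mapping.single v a * hom_comp (k - length v) (Poly_Mapping.single w b) else 0)"
      by (intro sum.cong) (auto simp: hom_comp_single)
    also have "\<dots> = hom_comp k (Poly_Mapping.single v a * Poly_Mapping.single w b)"
      by (subst sum.delta) (auto simp: hom_comp_single mult_single)
    finally show ?case by simp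
  qed (simp add: distrib_left hom_comp_add sum.distrib)
qed (simp add: distrib_right hom_comp_add sum.distrib)

lemma sum_hom_comp_eq:
  "\<exists>n. \<forall>k\<ge>n. (\<Sum>i\<le>k. hom_comp i f) = f"
proof (induction f rule: poly_mapping_additive_induct)
  case (single w c)
  show ?case by (intro exI[of _ "length w"]) (simp add: hom_comp_single)
next
  case (add f g)
  then obtain m n where "\<forall>k\<ge>m. (\<Sum>i\<le>k. hom_comp i f) = f" "\<forall>k\<ge>n. (\<Sum>i\<le>k. hom_comp i g) = g"
    by blast
  then show ?case by (intro exI[of _ "max m n"]) (simp add: hom_comp_add sum.distrib)
qed

lemma ex_hom_comp_vanish: "\<exists>n. \<forall>i>n. hom_comp i f = 0"
proof -
  obtain n where n: "(\<Sum>i\<le>n. hom_comp i f) = f" using sum_hom_comp_eq by blast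
  have "hom_comp i f = 0" if "i > n" for i
    by (subst n[symmetric]) (use that in \<open>auto simp: hom_comp_sum hom_comp_hom_comp intro!: sum.neutral\<close>)
  then show ?thesis by blast
qed

lemma free_part_iff: "f \<in> free_part k \<longleftrightarrow> hom_comp k f = f"
proof
  assume "f \<in> free_part k"
  then show "hom_comp k f = f"
    by (intro poly_mapping_eqI) (auto simp: free_part_def lookup_hom_comp in_keys_iff)
next
  assume "hom_comp k f = f"
  then have "Poly_Mapping.lookup f w = (if length w = k then Poly_Mapping.lookup f w else 0)" for w
    by (metis lookup_hom_comp)
  then show "f \<in> free_part k"
    by (auto simp: free_part_def in_keys_iff) metis
qed

lemma hom_comp_in_free_part: "hom_comp k f \<in> free_part k"
  by (simp add: free_part_iff hom_comp_hom_comp)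

lemma hom_comp_free_part: "f \<in> free_part k \<Longrightarrow> hom_comp i f = (if i = k then f else 0)"
  by (metis free_part_iff hom_comp_hom_comp)

lemma free_filt_iff_sum: "f \<in> free_filt k \<longleftrightarrow> (\<Sum>i\<le>k. hom_comp i f) = f"
proof
  assume "f \<in> free_filt k"
  then obtain g where g: "\<forall>i\<le>k. g i \<in> free_part i" "f = (\<Sum>i\<le>k. g i)"
    by (auto simp: free_filt_def)
  have "hom_comp i f = g i" if "i \<le> k" for i
  proof -
    have "hom_comp i f = (\<Sum>j\<le>k. if i = j then g j else 0)"
      unfolding g(2) hom_comp_sum by (intro sum.cong) (use g(1) in \<open>auto simp: hom_comp_free_part\<close>)
    then show ?thesis using that by (simp add: sum.delta)
  qed
  then show "(\<Sum>i\<le>k. hom_comp i f) = f" using g(2) by simp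
next
  assume "(\<Sum>i\<le>k. hom_comp i f) = f"
  then show "f \<in> free_filt k"
    unfolding free_filt_def
    by (intro CollectI exI[of _ "\<lambda>i. hom_comp i f"]) (auto simp: hom_comp_in_free_part)
qed

lemma free_filt_iff: "f \<in> free_filt k \<longleftrightarrow> (\<forall>i>k. hom_comp i f = 0)"
proof
  assume "f \<in> free_filt k"
  then have f: "(\<Sum>i\<le>k. hom_comp i f) = f" by (simp add: free_filt_iff_sum)
  show "\<forall>i>k. hom_comp i f = 0"
    by (subst f[symmetric]) (auto simp: hom_comp_sum hom_comp_hom_comp intro!: sum.neutral)
next
  assume *: "\<forall>i>k. hom_comp i f = 0"
  show "f \<in> free_filt k"
    unfolding free_filt_iff_sum
  proof (rule poly_mapping_eqI)
    fix w
    have "Poly_Mapping.lookup (hom_comp (length w) f) w = 0" if "length w > k" using * that by simp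
    then show "Poly_Mapping.lookup (\<Sum>i\<le>k. hom_comp i f) w = Poly_Mapping.lookup f w"
      by (auto simp: lookup_sum lookup_hom_comp sum.delta' not_le)
  qed
qed

lemma free_part_subset_free_filt: "free_part k \<subseteq> free_filt k"
  by (auto simp: free_filt_iff hom_comp_free_part)

lemma free_filt_add: "f \<in> free_filt k \<Longrightarrow> g \<in> free_filt k \<Longrightarrow> f + g \<in> free_filt k"
  and free_filt_uminus: "f \<in> free_filt k \<Longrightarrow> - f \<in> free_filt k"
  and free_filt_0: "0 \<in> free_filt k"
  by (auto simp: free_filt_iff hom_comp_add hom_comp_uminus)

lemma free_filt_mult:
  assumes "f \<in> free_filt i" "g \<in> free_filt j"
  shows "f * g \<in> free_filt (i + j)"
  unfolding free_filt_iff hom_comp_mult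
proof (intro allI impI sum.neutral ballI)
  fix k n assume k: "i + j < k" "n \<in> {..k}"
  show "hom_comp n f * hom_comp (k - n) g = 0"
  proof (cases "n > i")
    case True
    then show ?thesis using assms(1) by (simp add: free_filt_iff)
  next
    case False
    then have "k - n > j" using k by simp
    then show ?thesis using assms(2) by (simp add: free_filt_iff)
  qed
qed

lemma ncdeg_ge: "Poly_Mapping.lookup f w \<noteq> 0 \<Longrightarrow> length w \<le> ncdeg f"
  unfolding ncdeg_def by (intro Max_ge) (auto simp: in_keys_iff)

lemma in_free_filt_ncdeg: "f \<in> free_filt (ncdeg f)"
  unfolding free_filt_iff
proof (intro allI impI poly_mapping_eqI)
  fix i w assume "ncdeg f < i"
  then have "Poly_Mapping.lookup f w = 0" if "length w = i"
    using ncdeg_ge[of f w] that by linarith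
  then show "Poly_Mapping.lookup (hom_comp i f) w = Poly_Mapping.lookup 0 w"
    by (simp add: lookup_hom_comp)
qed

lemma ncdeg_le: "f \<in> free_filt k \<Longrightarrow> ncdeg f \<le> k"
proof -
  assume f: "f \<in> free_filt k"
  have "length w \<le> k" if "w \<in> Poly_Mapping.keys f" for w
  proof (rule ccontr)
    assume "\<not> length w \<le> k"
    then have "Poly_Mapping.lookup (hom_comp (length w) f) w = 0" using f by (simp add: free_filt_iff)
    then show False using that by (simp add: lookup_hom_comp in_keys_iff)
  qed
  then show ?thesis by (simp add: ncdeg_def)
qed

section \<open>Total degree, homogenization and specialization in \<open>T[z]\<close>\<close>

text \<open>The component of total degree \<open>n\<close>, where letters and \<open>z\<close> all have degree \<open>1\<close>.\<close>

definition tot_comp :: "nat \<Rightarrow> (nat \<Rightarrow>\<^sub>0 ('x, 'k::field) ncpoly) \<Rightarrow> (nat \<Rightarrow>\<^sub>0 ('x, 'k) ncpoly)"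
  where "tot_comp n q = (\<Sum>i\<le>n. Poly_Mapping.single (n - i) (hom_comp i (Poly_Mapping.lookup q (n - i))))"

text \<open>
  Homogenization to a prescribed degree \<open>n\<close>. Unlike \<^const>\<open>homogenize\<close>, whose degree depends on its
  argument, it is additive. Components of degree above \<open>n\<close> are discarded.
\<close>

definition homogenize_to :: "nat \<Rightarrow> ('x, 'k::field) ncpoly \<Rightarrow> (nat \<Rightarrow>\<^sub>0 ('x, 'k) ncpoly)"
  where "homogenize_to n f = (\<Sum>i\<le>n. Poly_Mapping.single (n - i) (hom_comp i f))"

definition z_one :: "(nat \<Rightarrow>\<^sub>0 ('x, 'k::field) ncpoly) \<Rightarrow> ('x, 'k) ncpoly"
  where "z_one q = (\<Sum>j \<in> Poly_Mapping.keys q. Poly_Mapping.lookup q j)"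

definition z_zero :: "(nat \<Rightarrow>\<^sub>0 ('x, 'k::field) ncpoly) \<Rightarrow> ('x, 'k) ncpoly"
  where "z_zero q = Poly_Mapping.lookup q 0"

lemma homogenize_eq: "homogenize f = homogenize_to (ncdeg f) f"
  by (simp add: homogenize_def homogenize_to_def)

lemma tot_comp_add: "tot_comp n (p + q) = tot_comp n p + tot_comp n q"
  by (simp add: tot_comp_def lookup_add hom_comp_add single_add sum.distrib)

lemma tot_comp_0 [simp]: "tot_comp n 0 = 0"
  by (simp add: tot_comp_def)

lemma tot_comp_monomial:
  "tot_comp n (Poly_Mapping.single j (Poly_Mapping.single w c)) =
    (if j + length w = n then Poly_Mapping.single j (Poly_Mapping.single w c) else 0)"
proof -
  have "tot_comp n (Poly_Mapping.single j (Poly_Mapping.single w c)) =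
      (\<Sum>i\<le>n. if i = length w then (if j + length w = n then Poly_Mapping.single j (Poly_Mapping.single w c) else 0) else 0)"
    unfolding tot_comp_def
    by (intro sum.cong) (auto simp: lookup_single when_def hom_comp_single)
  also have "\<dots> = (if j + length w = n then Poly_Mapping.single j (Poly_Mapping.single w c) else 0)"
    by (subst sum.delta) auto
  finally show ?thesis .
qed

lemma tot_comp_mult: "tot_comp n (p * q) = (\<Sum>i\<le>n. tot_comp i p * tot_comp (n - i) q)"
proof (induction p rule: monomial_induct)
  case (monomial j v a)
  let ?m = "Poly_Mapping.single j (Poly_Mapping.single v a)"
  show ?case
  proof (induction q rule: monomial_induct)
    case (monomial k w b)
    let ?m' = "Poly_Mapping.single k (Poly_Mapping.single w b)"
    have "(\<Sum>i\<le>n. tot_comp i ?m * tot_comp (n - i) ?m')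
        = (\<Sum>i\<le>n. if i = j + length v then ?m * tot_comp (n - (j + length v)) ?m' else 0)"
      by (intro sum.cong) (auto simp: tot_comp_monomial)
    also have "\<dots> = tot_comp n (?m * ?m')"
      by (subst sum.delta) (auto simp: tot_comp_monomial mult_single)
    finally show ?case by simp
  qed (simp add: distrib_left tot_comp_add sum.distrib)
qed (simp add: distrib_right tot_comp_add sum.distrib)

lemma sum_tot_comp_eq: "\<exists>n. \<forall>k\<ge>n. (\<Sum>i\<le>k. tot_comp i q) = q"
proof (induction q rule: monomial_induct)
  case (monomial j w c)
  show ?case by (intro exI[of _ "j + length w"]) (simp add: tot_comp_monomial)
next
  case (add f g)
  then obtain m n where "\<forall>k\<ge>m. (\<Sum>i\<le>k. tot_comp i f) = f" "\<forall>k\<ge>n. (\<Sum>i\<le>k. tot_comp i g) = g"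
    by blast
  then show ?case by (intro exI[of _ "max m n"]) (simp add: tot_comp_add sum.distrib)
qed

lemma homogenize_to_add: "homogenize_to n (f + g) = homogenize_to n f + homogenize_to n g"
  by (simp add: homogenize_to_def hom_comp_add single_add sum.distrib)

lemma homogenize_to_0 [simp]: "homogenize_to n 0 = 0"
  by (simp add: homogenize_to_def)

lemma homogenize_to_single:
  "homogenize_to n (Poly_Mapping.single w c) =
    (if length w \<le> n then Poly_Mapping.single (n - length w) (Poly_Mapping.single w c) else 0)"
proof -
  have "homogenize_to n (Poly_Mapping.single w c) =
      (\<Sum>i\<le>n. if i = length w then Poly_Mapping.single (n - length w) (Poly_Mapping.single w c) else 0)"
    unfolding homogenize_to_def by (intro sum.cong) (auto simp: hom_comp_single)
  also have "\<dots> = (if length w \<le> n then Poly_Mapping.single (n - length w) (Poly_Mapping.single w c) else 0)"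
    by (subst sum.delta) auto
  finally show ?thesis .
qed

lemma tot_comp_homogenize_to:
  "tot_comp k (homogenize_to n f) = (if k = n then homogenize_to n f else 0)"
  by (induction f rule: poly_mapping_additive_induct)
    (auto simp: homogenize_to_single tot_comp_monomial homogenize_to_add tot_comp_add)

lemma z_one_eq_sum:
  assumes "finite A" "Poly_Mapping.keys q \<subseteq> A"
  shows "z_one q = (\<Sum>j\<in>A. Poly_Mapping.lookup q j)"
  unfolding z_one_def using assms by (intro sum.mono_neutral_left) (auto simp: in_keys_iff)

lemma z_one_add: "z_one (p + q) = z_one p + z_one q"
proof -
  let ?A = "Poly_Mapping.keys p \<union> Poly_Mapping.keys q"
  have "z_one (p + q) = (\<Sum>j\<in>?A. Poly_Mapping.lookup (p + q) j)"
    by (intro z_one_eq_sum) (simp_all add: Poly_Mapping.keys_add)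
  also have "\<dots> = z_one p + z_one q"
    using z_one_eq_sum[of ?A p] z_one_eq_sum[of ?A q] by (simp add: lookup_add sum.distrib)
  finally show ?thesis .
qed

lemma z_one_single: "z_one (Poly_Mapping.single j f) = f"
  by (simp add: z_one_def)

lemma z_one_0 [simp]: "z_one 0 = 0"
  by (simp add: z_one_def)

lemma z_one_sum: "z_one (sum f A) = (\<Sum>a\<in>A. z_one (f a))"
  by (induction A rule: infinite_finite_induct) (simp_all add: z_one_add)

lemma z_one_mult: "z_one (p * q) = z_one p * z_one q"
proof (induction p rule: poly_mapping_additive_induct)
  case (single j f)
  show ?case
    by (induction q rule: poly_mapping_additive_induct)
      (simp_all add: mult_single z_one_single distrib_left z_one_add)
qed (simp add: distrib_right z_one_add)

lemma z_zero_add: "z_zero (p + q) = z_zero p + z_zero q"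
  by (simp add: z_zero_def lookup_add)

lemma z_zero_mult: "z_zero (p * q) = z_zero p * z_zero q"
proof (induction p rule: poly_mapping_additive_induct)
  case (single j f)
  show ?case
    by (induction q rule: poly_mapping_additive_induct)
      (auto simp: mult_single z_zero_def lookup_single when_def distrib_left lookup_add)
qed (simp add: distrib_right z_zero_add)

lemma z_zero_single_0: "z_zero (Poly_Mapping.single 0 f) = f"
  by (simp add: z_zero_def)

lemma z_zero_tot_comp: "z_zero (tot_comp k q) = hom_comp k (z_zero q)"
proof (induction q rule: monomial_induct)
  case (monomial j w c)
  then show ?case
    by (auto simp: tot_comp_monomial z_zero_def lookup_single when_def hom_comp_single)
qed (simp add: tot_comp_add z_zero_add hom_comp_add)

lemma z_one_homogenize_to: "z_one (homogenize_to n f) = (\<Sum>i\<le>n. hom_comp i f)"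
  by (simp add: homogenize_to_def z_one_sum z_one_single)

lemma z_zero_homogenize_to: "z_zero (homogenize_to n f) = hom_comp n f"
  by (induction f rule: poly_mapping_additive_induct)
    (auto simp: homogenize_to_single hom_comp_single homogenize_to_add hom_comp_add
      z_zero_def lookup_single when_def lookup_add)

lemma z_one_homogenize: "z_one (homogenize f) = f"
  using in_free_filt_ncdeg by (simp add: homogenize_eq z_one_homogenize_to free_filt_iff_sum)

text \<open>
  For \<open>k = n\<close> this says that a homogeneous element of \<open>T[z]\<close> is recovered from its value at \<open>z = 1\<close>;
  a larger \<open>k\<close> only adds powers of \<open>z\<close>.
\<close>

lemma homogenize_to_z_one_tot_comp:
  assumes "n \<le> k"
  shows "homogenize_to k (z_one (tot_comp n q)) = Poly_Mapping.single (k - n) 1 * tot_comp n q"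
proof (induction q rule: monomial_induct)
  case (monomial j w c)
  then show ?case using assms
    by (auto simp: tot_comp_monomial z_one_single homogenize_to_single mult_single)
qed (simp add: tot_comp_add z_one_add homogenize_to_add distrib_left)

lemma z_one_tot_comp_in_free_filt: "z_one (tot_comp n q) \<in> free_filt n"
proof (induction q rule: monomial_induct)
  case (monomial j w c)
  then show ?case by (auto simp: tot_comp_monomial z_one_single free_filt_iff hom_comp_single)
qed (simp add: tot_comp_add z_one_add free_filt_add)

text \<open>
  A term of total degree \<open>n\<close> keeps degree \<open>n\<close> at \<open>z = 1\<close> exactly when it is free of \<open>z\<close>, which is when
  it survives at \<open>z = 0\<close>.
\<close>

lemma hom_comp_z_one_tot_comp: "hom_comp n (z_one (tot_comp n q)) = z_zero (tot_comp n q)"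
proof (induction q rule: monomial_induct)
  case (monomial j w c)
  then show ?case
    by (auto simp: tot_comp_monomial z_one_single hom_comp_single z_zero_def lookup_single when_def)
qed (simp add: tot_comp_add z_one_add z_zero_add hom_comp_add)

lemma homogenize_to_lower:
  assumes "f \<in> free_filt n" "n \<le> k"
  shows "homogenize_to k f = Poly_Mapping.single (k - n) 1 * homogenize_to n f"
proof -
  have "z_one (tot_comp n (homogenize_to n f)) = f"
    using assms(1) by (simp add: tot_comp_homogenize_to z_one_homogenize_to free_filt_iff_sum)
  then show ?thesis
    using homogenize_to_z_one_tot_comp[OF assms(2), of "homogenize_to n f"]
    by (simp add: tot_comp_homogenize_to)
qed

lemma tot_comp_var_z_mult:
  "tot_comp (Suc n) (var_z * q) = var_z * tot_comp n q"
proof (induction q rule: monomial_induct)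
  case (monomial j w c)
  then show ?case by (auto simp: tot_comp_monomial var_z_def mult_single)
qed (simp add: distrib_left tot_comp_add)

section \<open>Quotients of rings whose carrier is a whole type\<close>

text \<open>
  Both \<^const>\<open>free_alg\<close> and \<^const>\<open>free_alg_z\<close> are built from the class operations of a type.
  The locale translates ideals, cosets and quotients into these operations, once for both.
\<close>

locale type_algebra = ring R for R :: "('k, 'r::ring_1) module" +
  fixes scal :: "'k \<Rightarrow> 'r"
  assumes carrier_eq [simp]: "carrier R = UNIV"
    and mult_eq [simp]: "monoid.mult R = (*)"
    and one_eq [simp]: "one R = 1"
    and zero_eq [simp]: "zero R = 0"
    and add_eq [simp]: "add R = (+)"
    and smult_eq [simp]: "smult R c x = scal c * x"
begin

lemma a_inv_eq: "a_inv R x = - x"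
  by (rule sym, rule minus_equality[symmetric]) auto

lemma ideal_iff:
  "ideal I R \<longleftrightarrow> 0 \<in> I \<and> (\<forall>x\<in>I. \<forall>y\<in>I. x + y \<in> I) \<and> (\<forall>x\<in>I. \<forall>a. a * x \<in> I \<and> x * a \<in> I)"
proof
  assume "ideal I R"
  then interpret ideal I R .
  show "0 \<in> I \<and> (\<forall>x\<in>I. \<forall>y\<in>I. x + y \<in> I) \<and> (\<forall>x\<in>I. \<forall>a. a * x \<in> I \<and> x * a \<in> I)"
    using zero_closed a_closed I_l_closed I_r_closed by simp
next
  assume I: "0 \<in> I \<and> (\<forall>x\<in>I. \<forall>y\<in>I. x + y \<in> I) \<and> (\<forall>x\<in>I. \<forall>a. a * x \<in> I \<and> x * a \<in> I)"
  have "- x \<in> I" if "x \<in> I" for x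
    using I that by (metis mult_minus1)
  then have inv: "m_inv (add_monoid R) x \<in> I" if "x \<in> I" for x
    using that a_inv_eq[of x] unfolding a_inv_def by metis
  have "subgroup I (add_monoid R)"
    by (rule subgroup.intro; (rule inv)?) (use I in auto)
  then show "ideal I R"
    using I by (intro idealI ring_axioms) auto
qed

lemma idealI':
  assumes "0 \<in> I" "\<And>x y. x \<in> I \<Longrightarrow> y \<in> I \<Longrightarrow> x + y \<in> I"
    and "\<And>a x. x \<in> I \<Longrightarrow> a * x \<in> I" "\<And>a x. x \<in> I \<Longrightarrow> x * a \<in> I"
  shows "ideal I R"
  using assms by (simp add: ideal_iff)

context
  fixes I
  assumes I: "ideal I R"
begin

lemma ideal_0: "0 \<in> I"
  and ideal_add: "x \<in> I \<Longrightarrow> y \<in> I \<Longrightarrow> x + y \<in> I"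
  and ideal_mult_left: "x \<in> I \<Longrightarrow> a * x \<in> I"
  and ideal_mult_right: "x \<in> I \<Longrightarrow> x * a \<in> I"
  using I by (auto simp: ideal_iff)

lemma ideal_uminus: "x \<in> I \<Longrightarrow> - x \<in> I"
  using ideal_mult_left[of x "- 1"] by simp

lemma ideal_diff: "x \<in> I \<Longrightarrow> y \<in> I \<Longrightarrow> x - y \<in> I"
  using ideal_add[of x "- y"] ideal_uminus by simp

lemma ideal_sum: "(\<And>a. a \<in> A \<Longrightarrow> f a \<in> I) \<Longrightarrow> sum f A \<in> I"
  by (induction A rule: infinite_finite_induct) (auto intro: ideal_0 ideal_add)

lemma coset_eq: "a_r_coset R I x = {y. y - x \<in> I}"
proof -
  have "y \<in> a_r_coset R I x" if "y - x \<in> I" for y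
    unfolding a_r_coset_def r_coset_def using that by (auto intro: bexI[of _ "y - x"])
  then show ?thesis
    by (auto simp: a_r_coset_def r_coset_def)
qed

lemma coset_eq_iff: "a_r_coset R I x = a_r_coset R I y \<longleftrightarrow> x - y \<in> I"
proof
  assume "a_r_coset R I x = a_r_coset R I y"
  moreover have "x \<in> a_r_coset R I x" by (simp add: coset_eq ideal_0)
  ultimately show "x - y \<in> I" by (simp add: coset_eq)
next
  assume xy: "x - y \<in> I"
  have "a - x \<in> I \<longleftrightarrow> a - y \<in> I" for a
    using ideal_add[OF _ xy, of "a - x"] ideal_diff[OF _ xy, of "a - y"] by auto
  then show "a_r_coset R I x = a_r_coset R I y" by (simp add: coset_eq)
qed

lemma coset_0: "a_r_coset R I 0 = I"
  by (simp add: coset_eq)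

lemma carrier_quot: "carrier (quot_alg R I) = range (a_r_coset R I)"
  by (auto simp: quot_alg_def FactRing_def A_RCOSETS_def RCOSETS_def a_r_coset_def)

lemma mult_quot:
  "monoid.mult (quot_alg R I) (a_r_coset R I x) (a_r_coset R I y) = a_r_coset R I (x * y)"
  using ideal.rcoset_mult_add[OF I, of x y] by (simp add: quot_alg_def FactRing_def)

lemma add_quot:
  "add (quot_alg R I) (a_r_coset R I x) (a_r_coset R I y) = a_r_coset R I (x + y)"
proof -
  interpret ideal I R by (rule I)
  show ?thesis using a_rcos_sum[of x y] by (simp add: quot_alg_def FactRing_def)
qed

lemma one_quot: "one (quot_alg R I) = a_r_coset R I 1"
  and zero_quot: "zero (quot_alg R I) = a_r_coset R I 0"
  by (simp_all add: quot_alg_def FactRing_def coset_0)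

text \<open>The union in \<^const>\<open>coset_smult\<close> is over equal cosets, since \<open>I\<close> absorbs scalars.\<close>

lemma smult_quot: "smult (quot_alg R I) c (a_r_coset R I x) = a_r_coset R I (scal c * x)"
proof -
  have "a_r_coset R I (scal c * y) = a_r_coset R I (scal c * x)" if "y \<in> a_r_coset R I x" for y
  proof -
    have "scal c * (y - x) \<in> I" using that by (intro ideal_mult_left) (simp add: coset_eq)
    then show ?thesis by (simp add: coset_eq_iff right_diff_distrib)
  qed
  moreover have "x \<in> a_r_coset R I x" by (simp add: coset_eq ideal_0)
  ultimately have "(\<Union>y \<in> a_r_coset R I x. a_r_coset R I (scal c * y)) = a_r_coset R I (scal c * x)"
    by blast
  then show ?thesis
    by (simp add: quot_alg_def coset_smult_def)
qed

lemma zero_divisor_quot_central: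
  assumes "\<And>g. z * g = g * z"
  shows "zero_divisor (quot_alg R I) (a_r_coset R I z) \<longleftrightarrow> (\<exists>g. g \<notin> I \<and> z * g \<in> I)"
proof -
  have "zero_divisor (quot_alg R I) (a_r_coset R I z) \<longleftrightarrow>
      (\<exists>g. a_r_coset R I g \<noteq> a_r_coset R I 0 \<and>
        (a_r_coset R I (z * g) = a_r_coset R I 0 \<or> a_r_coset R I (g * z) = a_r_coset R I 0))"
    unfolding zero_divisor_def carrier_quot zero_quot by (auto simp: mult_quot)
  then show ?thesis
    unfolding coset_eq_iff assms[symmetric] diff_0_right by blast
qed

end

end

interpretation free: type_algebra free_alg "Poly_Mapping.single 0"
  by (intro type_algebra.intro type_algebra_axioms.intro ring_free_alg) (simp_all add: free_alg_def)

interpretation free_z: type_algebra free_alg_z "\<lambda>c. Poly_Mapping.single 0 (Poly_Mapping.single 0 c)"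
  by (intro type_algebra.intro type_algebra_axioms.intro ring_free_alg_z) (simp_all add: free_alg_z_def)

text \<open>
  The two lemmas on ideals serve for the specializations \<open>z \<mapsto> 0\<close> and \<open>z \<mapsto> 1\<close>. The last
  assumption says that \<open>h\<close> fixes \<open>T\<close>; it makes \<open>h\<close> surjective, so that images of ideals are ideals.
\<close>

lemma ideal_image:
  fixes h :: "(nat \<Rightarrow>\<^sub>0 ('x, 'k::field) ncpoly) \<Rightarrow> ('x, 'k) ncpoly"
  assumes "ideal X free_alg_z"
    and "\<And>p q. h (p + q) = h p + h q" "\<And>p q. h (p * q) = h p * h q"
    and "\<And>f. h (Poly_Mapping.single 0 f) = f"
  shows "ideal (h ` X) free_alg"
proof (rule free.idealI')
  have "h 0 = 0" using assms(4)[of 0] by simp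
  then show "0 \<in> h ` X" using free_z.ideal_0[OF assms(1)] by force
next
  fix x y assume "x \<in> h ` X" "y \<in> h ` X"
  then show "x + y \<in> h ` X"
    using free_z.ideal_add[OF assms(1)] by (auto simp flip: assms(2))
next
  fix a x assume "x \<in> h ` X"
  then obtain p where p: "p \<in> X" "x = h p" by blast
  have "a * x = h (Poly_Mapping.single 0 a * p)" "x * a = h (p * Poly_Mapping.single 0 a)"
    by (simp_all add: assms p)
  then show "a * x \<in> h ` X" "x * a \<in> h ` X"
    using free_z.ideal_mult_left[OF assms(1) p(1)] free_z.ideal_mult_right[OF assms(1) p(1)] by blast+
qed

lemma ideal_vimage:
  fixes h :: "(nat \<Rightarrow>\<^sub>0 ('x, 'k::field) ncpoly) \<Rightarrow> ('x, 'k) ncpoly"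
  assumes "ideal X free_alg"
    and "\<And>p q. h (p + q) = h p + h q" "\<And>p q. h (p * q) = h p * h q"
    and "\<And>f. h (Poly_Mapping.single 0 f) = f"
  shows "ideal (h -` X) free_alg_z"
proof (rule free_z.idealI')
  have "h 0 = 0" using assms(4)[of 0] by simp
  then show "0 \<in> h -` X" using free.ideal_0[OF assms(1)] by simp
qed (auto simp: assms(2,3) intro: free.ideal_add[OF assms(1)]
      free.ideal_mult_left[OF assms(1)] free.ideal_mult_right[OF assms(1)])

section \<open>Leading forms and regularity of the central variable\<close>

abbreviation free_filt_prev :: "nat \<Rightarrow> ('x, 'k::field) ncpoly set"
  where "free_filt_prev \<equiv> filt_prev free_alg free_filt"

lemma in_filt_prev_iff: "g \<in> free_filt_prev k \<longleftrightarrow> (\<forall>i\<ge>k. hom_comp i g = 0)"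
proof (cases k)
  case 0
  have "g = 0" if "\<forall>i. hom_comp i g = 0"
    using sum_hom_comp_eq[of g] that by auto
  then show ?thesis by (auto simp: filt_prev_def 0)
next
  case (Suc j)
  then show ?thesis by (auto simp: filt_prev_def free_filt_iff)
qed

definition leading_forms :: "('x, 'k::field) ncpoly set \<Rightarrow> nat \<Rightarrow> ('x, 'k) ncpoly set"
  where "leading_forms J k = {f \<in> free_part k. \<exists>g \<in> free_filt_prev k. f + g \<in> J}"

locale deformed_relations =
  fixes m :: nat and r l :: "nat \<Rightarrow> ('x, 'k::field) ncpoly"
  assumes graded: "graded_relations m r"
    and deformed: "deformation_terms m r l"
begin

abbreviation I where "I \<equiv> rel_ideal m r"
abbreviation J where "J \<equiv> rel_ideal m (\<lambda>i. r i + l i)"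
abbreviation H where "H \<equiv> ext_ideal m r l"

lemma ideal_I: "ideal I free_alg"
  and ideal_J: "ideal J free_alg"
  and ideal_H: "ideal H free_alg_z"
  unfolding rel_ideal_def ext_ideal_def
  by (simp_all add: free.genideal_ideal free_z.genideal_ideal)

lemma relation_in_ideals:
  assumes "i < m"
  shows "r i \<in> I" "r i + l i \<in> J" "homogenize (r i + l i) \<in> H"
  using assms free.genideal_self[of "r ` {..<m}"] free.genideal_self[of "(\<lambda>i. r i + l i) ` {..<m}"]
    free_z.genideal_self[of "(\<lambda>i. homogenize (r i + l i)) ` {..<m}"]
  by (auto simp: rel_ideal_def ext_ideal_def)

lemma I_subset: "ideal X free_alg \<Longrightarrow> (\<And>i. i < m \<Longrightarrow> r i \<in> X) \<Longrightarrow> I \<subseteq> X"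
  and J_subset: "ideal X free_alg \<Longrightarrow> (\<And>i. i < m \<Longrightarrow> r i + l i \<in> X) \<Longrightarrow> J \<subseteq> X"
  unfolding rel_ideal_def by (rule free.genideal_minimal; auto)+

lemma H_subset:
  "ideal Y free_alg_z \<Longrightarrow> (\<And>i. i < m \<Longrightarrow> homogenize (r i + l i) \<in> Y) \<Longrightarrow> H \<subseteq> Y"
  unfolding ext_ideal_def by (rule free_z.genideal_minimal; auto)

text \<open>
  The degree bound on \<open>l i\<close> also forces \<open>r i \<noteq> 0\<close>, as it makes the degree of \<open>r i\<close> positive.
  So \<open>r i + l i\<close> has the degree of \<open>r i\<close>, and its leading form is \<open>r i\<close>.
\<close>

lemma top_relation:
  assumes "i < m"
  shows "hom_comp (ncdeg (r i + l i)) (r i + l i) = r i"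
proof -
  obtain d where d: "r i \<in> free_part d"
    using graded assms unfolding graded_relations_def by blast
  have less: "ncdeg (l i) < ncdeg (r i)"
    using deformed assms unfolding deformation_terms_def by blast
  have "ncdeg (r i) \<le> d"
    using ncdeg_le d free_part_subset_free_filt by blast
  then have l: "hom_comp j (l i) = 0" if "j \<ge> d" for j
    using in_free_filt_ncdeg[of "l i"] less that by (simp add: free_filt_iff)
  have top: "hom_comp d (r i + l i) = r i"
    using d l by (simp add: hom_comp_add hom_comp_free_part)
  have "r i \<noteq> 0" using less by (auto simp: ncdeg_def)
  then have "d \<le> ncdeg (r i + l i)"
    using in_free_filt_ncdeg[of "r i + l i"] top by (metis free_filt_iff not_le)
  moreover have "r i + l i \<in> free_filt d"
    using d l by (auto simp: free_filt_iff hom_comp_add hom_comp_free_part)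
  ultimately show ?thesis using ncdeg_le top by fastforce
qed

text \<open>
  Elements all of whose components lie in \<open>H\<close> form an ideal, and that ideal contains the homogeneous
  generators of \<open>H\<close>.
\<close>

lemma tot_comp_in_H:
  assumes "q \<in> H"
  shows "tot_comp n q \<in> H"
proof -
  let ?Y = "{q. \<forall>n. tot_comp n q \<in> H}"
  note H = free_z.ideal_0[OF ideal_H] free_z.ideal_add[OF ideal_H]
    free_z.ideal_sum[OF ideal_H] free_z.ideal_mult_left[OF ideal_H] free_z.ideal_mult_right[OF ideal_H]
  have "ideal ?Y free_alg_z"
    by (rule free_z.idealI') (auto simp: tot_comp_add tot_comp_mult intro: H)
  then have "H \<subseteq> ?Y"
    by (rule H_subset) (auto simp: homogenize_eq tot_comp_homogenize_to relation_in_ideals(3)[unfolded homogenize_eq] H)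
  then show ?thesis using assms by blast
qed

lemma z_zero_homogenized_relation: "i < m \<Longrightarrow> z_zero (homogenize (r i + l i)) = r i"
  by (simp add: homogenize_eq z_zero_homogenize_to top_relation)

lemma I_eq: "I = z_zero ` H"
proof
  show "I \<subseteq> z_zero ` H"
    using ideal_image[OF ideal_H z_zero_add z_zero_mult z_zero_single_0]
    by (rule I_subset) (metis relation_in_ideals(3) z_zero_homogenized_relation imageI)
  have "H \<subseteq> z_zero -` I"
    using ideal_vimage[OF ideal_I z_zero_add z_zero_mult z_zero_single_0]
    by (rule H_subset) (simp add: z_zero_homogenized_relation relation_in_ideals)
  then show "z_zero ` H \<subseteq> I" by blast
qed

lemma J_eq: "J = z_one ` H"
proof
  show "J \<subseteq> z_one ` H"
    using ideal_image[OF ideal_H z_one_add z_one_mult z_one_single]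
    by (rule J_subset) (metis relation_in_ideals(3) z_one_homogenize imageI)
  have "H \<subseteq> z_one -` J"
    using ideal_vimage[OF ideal_J z_one_add z_one_mult z_one_single]
    by (rule H_subset) (simp add: z_one_homogenize relation_in_ideals)
  then show "z_one ` H \<subseteq> J" by blast
qed

lemma hom_comp_in_I: "f \<in> I \<Longrightarrow> hom_comp k f \<in> I"
  unfolding I_eq using tot_comp_in_H z_zero_tot_comp by (metis (no_types, lifting) imageE imageI)

lemma homogeneous_lift_in_H:
  assumes "f \<in> I"
  obtains q where "q \<in> H" "tot_comp k q = q" "z_zero q = hom_comp k f"
proof -
  obtain p where "p \<in> H" "z_zero p = f" using assms by (auto simp: I_eq)
  moreover have "tot_comp k (tot_comp k p) = tot_comp k p"
    by (induction p rule: monomial_induct) (auto simp: tot_comp_monomial tot_comp_add)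
  ultimately show thesis
    using that[of "tot_comp k p"] by (simp add: tot_comp_in_H z_zero_tot_comp)
qed

text \<open>
  A homogeneous element of \<open>I\<close> lifts to a homogeneous element of \<open>H\<close>, whose value at \<open>z = 1\<close> lies in
  \<open>J\<close> and differs from the given element by terms of lower degree.
\<close>

lemma I_subset_leading_forms: "f \<in> I \<Longrightarrow> f \<in> free_part k \<Longrightarrow> f \<in> leading_forms J k"
proof -
  assume f: "f \<in> I" "f \<in> free_part k"
  obtain q where q: "q \<in> H" "tot_comp k q = q" "z_zero q = f"
    using homogeneous_lift_in_H[OF f(1), of k] f(2) by (auto simp: free_part_iff)
  have "z_one q \<in> free_filt k" "hom_comp k (z_one q) = f"
    using z_one_tot_comp_in_free_filt[of k q] hom_comp_z_one_tot_comp[of k q] by (simp_all add: q)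
  then have "z_one q - f \<in> free_filt_prev k"
    using f(2) by (auto simp: in_filt_prev_iff hom_comp_diff free_filt_iff hom_comp_free_part)
  moreover have "f + (z_one q - f) \<in> J" using q by (auto simp: J_eq)
  ultimately show ?thesis using f(2) unfolding leading_forms_def by blast
qed

text \<open>
  The component of degree \<open>n\<close> of \<open>u\<close> lies in \<open>I\<close>, so it is the value at \<open>z = 0\<close> of a homogeneous \<open>q \<in> H\<close>.
  The value of \<open>q\<close> at \<open>z = 1\<close> lies in \<open>J\<close> and has the same component of degree \<open>n\<close>, so that \<open>u\<close> minus
  this value has degree below \<open>n\<close> and still lies in \<open>J\<close>.
\<close>

lemma homogenize_to_in_H:
  assumes leading: "\<And>k. leading_forms J k \<subseteq> I"
    and "u \<in> J" "u \<in> free_filt n"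
  shows "homogenize_to n u \<in> H"
  using assms(2,3)
proof (induction n arbitrary: u rule: less_induct)
  case (less n)
  note u = less.prems
  have "u - hom_comp n u \<in> free_filt_prev n"
    using u(2) by (auto simp: in_filt_prev_iff hom_comp_diff free_filt_iff hom_comp_hom_comp)
  then have "hom_comp n u \<in> leading_forms J n"
    using u(1) unfolding leading_forms_def
    by (intro CollectI conjI bexI[of _ "u - hom_comp n u"]) (simp_all add: hom_comp_in_free_part)
  then have "hom_comp n u \<in> I" using leading by blast
  then obtain q where q: "q \<in> H" "tot_comp n q = q" "z_zero q = hom_comp n u"
    by (rule homogeneous_lift_in_H[of _ n]) (simp add: hom_comp_hom_comp)
  let ?v = "u - z_one q"
  have v: "?v \<in> J" "?v \<in> free_filt_prev n"
  proof -
    show "?v \<in> J" using free.ideal_diff[OF ideal_J u(1)] q(1) by (simp add: J_eq)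
    have "z_one q \<in> free_filt n" "hom_comp n (z_one q) = hom_comp n u"
      using z_one_tot_comp_in_free_filt[of n q] hom_comp_z_one_tot_comp[of n q] by (simp_all add: q)
    then have "hom_comp i ?v = 0" if "i \<ge> n" for i
      using u(2) that by (cases "i = n") (auto simp: hom_comp_diff free_filt_iff)
    then show "?v \<in> free_filt_prev n" by (simp add: in_filt_prev_iff)
  qed
  have "homogenize_to n ?v \<in> H"
  proof (cases n)
    case 0
    then have "?v = 0" using v(2) by (simp add: filt_prev_def)
    then show ?thesis using free_z.ideal_0[OF ideal_H] by (metis homogenize_to_0)
  next
    case (Suc k)
    then have "?v \<in> free_filt k" using v(2) by (simp add: filt_prev_def)
    then show ?thesis
      using less.IH[OF _ v(1)] free_z.ideal_mult_left[OF ideal_H] homogenize_to_lower[of ?v k n] Suc by simp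
  qed
  moreover have "homogenize_to n (z_one q) = q"
    using homogenize_to_z_one_tot_comp[of n n q] by (simp add: q(2))
  ultimately show ?case
    using free_z.ideal_add[OF ideal_H _ q(1), of "homogenize_to n ?v"]
      homogenize_to_add[of n ?v "z_one q"] by simp
qed

lemma regular_iff_leading_forms:
  "regular_central_extension m r l \<longleftrightarrow> (\<forall>k. leading_forms J k \<subseteq> I)"
proof -
  have "regular_central_extension m r l \<longleftrightarrow> (\<forall>g. var_z * g \<in> H \<longrightarrow> g \<in> H)"
    unfolding regular_central_extension_def central_ext_def
      free_z.zero_divisor_quot_central[OF ideal_H var_z_central] by blast
  also have "\<dots> \<longleftrightarrow> (\<forall>k. leading_forms J k \<subseteq> I)"
  proof
    assume regular: "\<forall>g. var_z * g \<in> H \<longrightarrow> g \<in> H"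
    \<comment> \<open>Regularity of \<open>z\<close> gives that of each of its powers.\<close>
    have cancel: "g \<in> H" if "Poly_Mapping.single n 1 * g \<in> H" for n g
      using that
    proof (induction n)
      case 0
      then show ?case by simp
    next
      case (Suc n)
      have "Poly_Mapping.single (Suc n) (1 :: ('x, 'k) ncpoly) = var_z * Poly_Mapping.single n 1"
        by (simp add: var_z_def mult_single)
      then have "var_z * (Poly_Mapping.single n 1 * g) \<in> H"
        using Suc.prems by (simp add: mult.assoc)
      then show ?case using Suc.IH regular by blast
    qed
    show "\<forall>k. leading_forms J k \<subseteq> I"
    proof (intro allI subsetI)
      fix k f assume "f \<in> leading_forms J k"
      then obtain g where f: "f \<in> free_part k" and g: "g \<in> free_filt_prev k"
        and J: "f + g \<in> J"
        by (auto simp: leading_forms_def)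
      then obtain q where q: "q \<in> H" "z_one q = f + g" by (auto simp: J_eq)
      obtain n where n: "\<forall>j\<ge>n. (\<Sum>i\<le>j. tot_comp i q) = q" using sum_tot_comp_eq by blast
      \<comment> \<open>The degree \<open>j\<close> bounds both the lift \<open>q\<close> and \<open>f + g\<close>. In degree \<open>j\<close> the homogenization of
        \<open>f + g\<close> is a combination of the components of \<open>q\<close>.\<close>
      define j where "j = max n k"
      have "homogenize_to j (f + g) = homogenize_to j (z_one (\<Sum>i\<le>j. tot_comp i q))"
        using n q(2) by (simp add: j_def)
      also have "\<dots> = (\<Sum>i\<le>j. homogenize_to j (z_one (tot_comp i q)))"
      proof -
        have "homogenize_to j (z_one (sum p A)) = (\<Sum>i\<in>A. homogenize_to j (z_one (p i)))"
          for p :: "nat \<Rightarrow> nat \<Rightarrow>\<^sub>0 ('x, 'k) ncpoly" and A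
          by (induction A rule: infinite_finite_induct) (simp_all add: z_one_add homogenize_to_add)
        then show ?thesis .
      qed
      also have "\<dots> = (\<Sum>i\<le>j. Poly_Mapping.single (j - i) 1 * tot_comp i q)"
        by (intro sum.cong) (simp_all add: homogenize_to_z_one_tot_comp)
      also have "\<dots> \<in> H"
        by (intro free_z.ideal_sum[OF ideal_H] free_z.ideal_mult_left[OF ideal_H] tot_comp_in_H q(1))
      finally have "homogenize_to j (f + g) \<in> H" .
      moreover have "f + g \<in> free_filt k"
        using f g by (auto simp: free_filt_iff in_filt_prev_iff hom_comp_add hom_comp_free_part)
      ultimately have "homogenize_to k (f + g) \<in> H"
        using homogenize_to_lower[of "f + g" k j] by - (rule cancel[of "j - k"], simp add: j_def)
      moreover have "z_zero (homogenize_to k (f + g)) = f"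
        using f g by (simp add: z_zero_homogenize_to hom_comp_add in_filt_prev_iff hom_comp_free_part)
      ultimately show "f \<in> I" unfolding I_eq by force
    qed
  next
    assume leading: "\<forall>k. leading_forms J k \<subseteq> I"
    show "\<forall>g. var_z * g \<in> H \<longrightarrow> g \<in> H"
    proof (intro allI impI)
      fix g assume g: "var_z * g \<in> H"
      have "tot_comp n g \<in> H" for n
      proof -
        have "var_z * tot_comp n g \<in> H"
          using tot_comp_in_H[OF g, of "Suc n"] by (simp add: tot_comp_var_z_mult)
        then have "z_one (var_z * tot_comp n g) \<in> J" by (simp add: J_eq)
        then have "z_one (tot_comp n g) \<in> J"
          by (simp add: z_one_mult var_z_def z_one_single)
        then have "homogenize_to n (z_one (tot_comp n g)) \<in> H"
          using leading z_one_tot_comp_in_free_filt by (intro homogenize_to_in_H) auto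
        then show ?thesis by (simp add: homogenize_to_z_one_tot_comp)
      qed
      then show "g \<in> H"
        using sum_tot_comp_eq[of g] free_z.ideal_sum[OF ideal_H] by (metis order_refl)
    qed
  qed
  finally show ?thesis .
qed

end

section \<open>The associated graded algebra of a filtered quotient\<close>

lemma filt_prev_0: "0 \<in> free_filt_prev k"
  and filt_prev_add: "f \<in> free_filt_prev k \<Longrightarrow> g \<in> free_filt_prev k \<Longrightarrow> f + g \<in> free_filt_prev k"
  and filt_prev_uminus: "f \<in> free_filt_prev k \<Longrightarrow> - f \<in> free_filt_prev k"
  by (auto simp: in_filt_prev_iff hom_comp_add hom_comp_uminus)

lemma filt_prev_subset: "free_filt_prev k \<subseteq> free_filt k"
  by (auto simp: in_filt_prev_iff free_filt_iff)

lemma filt_prev_mult_left: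
  assumes "f \<in> free_filt_prev i" "g \<in> free_filt j"
  shows "f * g \<in> free_filt_prev (i + j)"
  unfolding in_filt_prev_iff hom_comp_mult
proof (intro allI impI sum.neutral ballI)
  fix k n assume k: "i + j \<le> k" "n \<in> {..k}"
  show "hom_comp n f * hom_comp (k - n) g = 0"
  proof (cases "n \<ge> i")
    case True
    then show ?thesis using assms(1) by (simp add: in_filt_prev_iff)
  next
    case False
    then have "k - n > j" using k by simp
    then show ?thesis using assms(2) by (simp add: free_filt_iff)
  qed
qed

lemma filt_prev_mult_right:
  assumes "f \<in> free_filt i" "g \<in> free_filt_prev j"
  shows "f * g \<in> free_filt_prev (i + j)"
  unfolding in_filt_prev_iff hom_comp_mult
proof (intro allI impI sum.neutral ballI)
  fix k n assume k: "i + j \<le> k" "n \<in> {..k}"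
  show "hom_comp n f * hom_comp (k - n) g = 0"
  proof (cases "n > i")
    case True
    then show ?thesis using assms(1) by (simp add: free_filt_iff)
  next
    case False
    then have "k - n \<ge> j" using k by simp
    then show ?thesis using assms(2) by (simp add: in_filt_prev_iff)
  qed
qed

lemma hom_comp_in_free_filt: "hom_comp k f \<in> free_filt k"
  using hom_comp_in_free_part free_part_subset_free_filt by blast

lemma hom_comp_scalar:
  "hom_comp k (Poly_Mapping.single 0 c * f) = Poly_Mapping.single 0 c * hom_comp k f"
  by (induction f rule: poly_mapping_additive_induct)
    (auto simp: mult_single hom_comp_single distrib_left hom_comp_add)

locale filtered_quotient =
  fixes J :: "('x, 'k::field) ncpoly set"
  assumes ideal_J: "ideal J free_alg"
begin

abbreviation U where "U \<equiv> quot_alg free_alg J"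
abbreviation F where "F \<equiv> quot_family free_alg J free_filt"
abbreviation cls where "cls \<equiv> a_r_coset free_alg J"

lemma filt_prev_quot: "filt_prev U F k = cls ` free_filt_prev k"
  by (cases k) (simp_all add: filt_prev_def quot_family_def free.zero_quot[OF ideal_J])

text \<open>
  The class in \<open>F\<^sup>k(U)/F\<^sup>k\<^sup>-\<^sup>1(U)\<close> of the image in \<open>U\<close> of \<open>f\<close>, as the literal set of cosets of \<open>J\<close>
  that occurs in \<^const>\<open>gr_comp\<close>.
\<close>

definition gr_class :: "nat \<Rightarrow> ('x, 'k) ncpoly \<Rightarrow> ('x, 'k) ncpoly set set"
  where "gr_class k f = (\<lambda>p. cls (p + f)) ` free_filt_prev k"

lemma coset_filt_prev: "a_r_coset U (filt_prev U F k) (cls f) = gr_class k f"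
  by (auto simp: filt_prev_quot a_r_coset_def[of U] r_coset_def gr_class_def free.add_quot[OF ideal_J])

lemma gr_class_0: "gr_class k 0 = filt_prev U F k"
  by (simp add: filt_prev_quot gr_class_def)

lemma gr_class_cong:
  assumes "p \<in> free_filt_prev k" "f - g - p \<in> J"
  shows "gr_class k f = gr_class k g"
proof
  have "cls (q + f) \<in> gr_class k g" if "q \<in> free_filt_prev k" for q
  proof -
    have "cls (q + f) = cls (q + p + g)"
      using assms(2) by (simp add: free.coset_eq_iff[OF ideal_J] algebra_simps)
    then show ?thesis using filt_prev_add[OF that assms(1)] by (auto simp: gr_class_def)
  qed
  then show "gr_class k f \<subseteq> gr_class k g" unfolding gr_class_def[of k f] by blast
  have "cls (q + g) \<in> gr_class k f" if "q \<in> free_filt_prev k" for q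
  proof -
    have "cls (q + g) = cls (q + - p + f)"
      using free.ideal_uminus[OF ideal_J assms(2)]
      by (simp add: free.coset_eq_iff[OF ideal_J] algebra_simps)
    then show ?thesis
      using filt_prev_add[OF that filt_prev_uminus[OF assms(1)]] by (auto simp: gr_class_def)
  qed
  then show "gr_class k g \<subseteq> gr_class k f" unfolding gr_class_def[of k g] by blast
qed

lemma gr_class_eq_iff: "gr_class k f = gr_class k g \<longleftrightarrow> (\<exists>p \<in> free_filt_prev k. f - g - p \<in> J)"
proof
  assume "gr_class k f = gr_class k g"
  moreover have "cls (0 + f) \<in> gr_class k f" unfolding gr_class_def using filt_prev_0 by blast
  ultimately obtain p where "p \<in> free_filt_prev k" "cls f = cls (p + g)"
    by (auto simp: gr_class_def)
  then show "\<exists>p \<in> free_filt_prev k. f - g - p \<in> J"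
    by (intro bexI[of _ p]) (auto simp: free.coset_eq_iff[OF ideal_J] algebra_simps)
qed (elim bexE, rule gr_class_cong)

lemma gr_class_cong': "f - g \<in> free_filt_prev k \<Longrightarrow> gr_class k f = gr_class k g"
  by (rule gr_class_cong[of "f - g"]) (simp_all add: free.ideal_0[OF ideal_J])

lemma carrier_gr_comp: "carrier (gr_comp U F k) = gr_class k ` free_filt k"
  using coset_filt_prev[unfolded a_r_coset_def[of U]]
  by (auto simp: gr_comp_def FactGroup_def RCOSETS_def r_coset_def quot_family_def)

lemma one_gr_comp: "one (gr_comp U F k) = gr_class k 0"
  by (simp add: gr_comp_def gr_class_0)

lemma mult_gr_comp: "monoid.mult (gr_comp U F k) (gr_class k f) (gr_class k g) = gr_class k (f + g)"
proof -
  have "monoid.mult (gr_comp U F k) (gr_class k f) (gr_class k g) =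
      (\<Union>p\<in>free_filt_prev k. \<Union>q\<in>free_filt_prev k. {cls (p + q + (f + g))})"
    by (simp add: gr_comp_def set_mult_def gr_class_def free.add_quot[OF ideal_J] algebra_simps)
  also have "\<dots> = gr_class k (f + g)"
  proof -
    have "cls (p + (f + g)) \<in> (\<Union>p\<in>free_filt_prev k. \<Union>q\<in>free_filt_prev k. {cls (p + q + (f + g))})"
      if "p \<in> free_filt_prev k" for p
      using that filt_prev_0[of k] by (intro UN_I[of p] UN_I[of 0]) simp_all
    then show ?thesis
      unfolding gr_class_def using filt_prev_add by blast
  qed
  finally show ?thesis .
qed

lemma comm_group_gr_comp: "comm_group (gr_comp U F k)"
proof (rule comm_groupI)
  fix x assume "x \<in> carrier (gr_comp U F k)"
  then obtain f where f: "f \<in> free_filt k" "x = gr_class k f" by (auto simp: carrier_gr_comp)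
  show "\<exists>y\<in>carrier (gr_comp U F k). y \<otimes>\<^bsub>gr_comp U F k\<^esub> x = \<one>\<^bsub>gr_comp U F k\<^esub>"
    by (intro bexI[of _ "gr_class k (- f)"])
      (simp_all add: f mult_gr_comp one_gr_comp carrier_gr_comp free_filt_uminus)
qed (auto simp: carrier_gr_comp one_gr_comp mult_gr_comp free_filt_0 algebra_simps intro: free_filt_add)

lemma finprod_gr_comp:
  assumes "finite A" "\<And>i. i \<in> A \<Longrightarrow> u i \<in> free_filt k"
  shows "finprod (gr_comp U F k) (\<lambda>i. gr_class k (u i)) A = gr_class k (sum u A)"
proof -
  interpret comm_group "gr_comp U F k" by (rule comm_group_gr_comp)
  show ?thesis
    using assms
    by (induction A rule: finite_induct)
      (auto simp: one_gr_comp mult_gr_comp carrier_gr_comp Pi_iff)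
qed

lemma rcoset_mult_gr_class:
  assumes "f \<in> free_filt i" "g \<in> free_filt (k - i)" "i \<le> k"
  shows "rcoset_mult U (filt_prev U F k) (gr_class i f) (gr_class (k - i) g) = gr_class k (f * g)"
proof -
  have *: "gr_class k ((p + f) * (q + g)) = gr_class k (f * g)"
    if p: "p \<in> free_filt_prev i" and q: "q \<in> free_filt_prev (k - i)" for p q
  proof (rule gr_class_cong')
    have "p * (q + g) \<in> free_filt_prev (i + (k - i))"
      using p q assms filt_prev_subset by (intro filt_prev_mult_left free_filt_add) blast+
    moreover have "f * q \<in> free_filt_prev (i + (k - i))"
      using q assms by (intro filt_prev_mult_right)
    ultimately have "p * (q + g) + f * q \<in> free_filt_prev (i + (k - i))" by (rule filt_prev_add)
    then show "(p + f) * (q + g) - f * g \<in> free_filt_prev k"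
      using assms(3) by (simp add: algebra_simps)
  qed
  have "rcoset_mult U (filt_prev U F k) (gr_class i f) (gr_class (k - i) g) =
      (\<Union>p\<in>free_filt_prev i. \<Union>q\<in>free_filt_prev (k - i). gr_class k ((p + f) * (q + g)))"
    by (simp add: rcoset_mult_def gr_class_def[of i] gr_class_def[of "k - i"]
        free.mult_quot[OF ideal_J] coset_filt_prev)
  also have "\<dots> = gr_class k (f * g)"
  proof -
    have "free_filt_prev i \<noteq> ({} :: ('x, 'k) ncpoly set)" "free_filt_prev (k - i) \<noteq> ({} :: ('x, 'k) ncpoly set)"
      using filt_prev_0 by blast+
    then show ?thesis by (simp add: * cong: SUP_cong_simp)
  qed
  finally show ?thesis .
qed

lemma smult_gr_class:
  "coset_smult U (filt_prev U F k) c (gr_class k f) = gr_class k (Poly_Mapping.single 0 c * f)"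
proof -
  have *: "gr_class k (Poly_Mapping.single 0 c * (p + f)) = gr_class k (Poly_Mapping.single 0 c * f)"
    if "p \<in> free_filt_prev k" for p
    using that by (intro gr_class_cong') (simp add: algebra_simps in_filt_prev_iff hom_comp_scalar)
  have "coset_smult U (filt_prev U F k) c (gr_class k f) =
      (\<Union>p\<in>free_filt_prev k. gr_class k (Poly_Mapping.single 0 c * (p + f)))"
    by (simp add: coset_smult_def gr_class_def[of k f] free.smult_quot[OF ideal_J] coset_filt_prev)
  also have "\<dots> = gr_class k (Poly_Mapping.single 0 c * f)"
  proof -
    have "free_filt_prev k \<noteq> ({} :: ('x, 'k) ncpoly set)"
      using filt_prev_0 by blast
    then show ?thesis by (simp add: * cong: SUP_cong_simp)
  qed
  finally show ?thesis .
qed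

text \<open>
  The canonical graded map from the free algebra to \<open>gr(U)\<close>. The lemmas below show that it is
  a surjective algebra homomorphism, which gives an explicit description of \<^const>\<open>gr_alg\<close>.
\<close>

definition symbol :: "('x, 'k) ncpoly \<Rightarrow> nat \<Rightarrow> ('x, 'k) ncpoly set set"
  where "symbol f k = gr_class k (hom_comp k f)"

text \<open>The kernel of \<^const>\<open>symbol\<close> is spanned by the leading forms of \<open>J\<close>.\<close>

lemma symbol_eq_iff: "symbol f = symbol g \<longleftrightarrow> (\<forall>k. hom_comp k (f - g) \<in> leading_forms J k)"
proof -
  have "symbol f k = symbol g k \<longleftrightarrow> hom_comp k (f - g) \<in> leading_forms J k" for k
  proof -
    have "symbol f k = symbol g k \<longleftrightarrow> (\<exists>p \<in> free_filt_prev k. hom_comp k (f - g) - p \<in> J)"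
      by (simp only: symbol_def gr_class_eq_iff hom_comp_diff)
    also have "\<dots> \<longleftrightarrow> (\<exists>p \<in> free_filt_prev k. hom_comp k (f - g) + p \<in> J)"
      using filt_prev_uminus[of _ k] by (metis add_uminus_conv_diff minus_minus)
    also have "\<dots> \<longleftrightarrow> hom_comp k (f - g) \<in> leading_forms J k"
      by (simp add: leading_forms_def hom_comp_in_free_part)
    finally show ?thesis .
  qed
  then show ?thesis by (simp only: fun_eq_iff)
qed

lemma finite_symbol_support: "finite {k. symbol f k \<noteq> gr_class k 0}"
proof -
  obtain n where "\<forall>i>n. hom_comp i f = 0" using ex_hom_comp_vanish by blast
  then have "{k. symbol f k \<noteq> gr_class k 0} \<subseteq> {..n}"
    by (auto simp: symbol_def)
  then show ?thesis by (rule finite_subset) simp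
qed

lemma carrier_gr_alg: "carrier (gr_alg U F) = range symbol"
proof -
  have "carrier (gr_alg U F) =
      {\<gamma>. (\<forall>k. \<gamma> k \<in> gr_class k ` free_filt k) \<and> finite {k. \<gamma> k \<noteq> gr_class k 0}}"
    using comm_group_gr_comp
    by (auto simp: gr_alg_def carrier_sum_group comm_group.axioms(2) carrier_gr_comp one_gr_comp PiE_iff)
  also have "\<dots> = range symbol"
  proof (intro equalityI subsetI)
    fix \<gamma> assume "\<gamma> \<in> {\<gamma>. (\<forall>k. \<gamma> k \<in> gr_class k ` free_filt k) \<and> finite {k. \<gamma> k \<noteq> gr_class k 0}}"
    then have "\<forall>k. \<exists>f. f \<in> free_filt k \<and> \<gamma> k = gr_class k f" and fin: "finite {k. \<gamma> k \<noteq> gr_class k 0}"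
      by auto
    then obtain f where f: "\<And>k. f k \<in> free_filt k" "\<And>k. \<gamma> k = gr_class k (f k)" by metis
    \<comment> \<open>A preimage must be a finite sum, so representatives are only taken on the support of \<open>\<gamma>\<close>.\<close>
    let ?f = "\<Sum>i\<in>{k. \<gamma> k \<noteq> gr_class k 0}. hom_comp i (f i)"
    have "symbol ?f k = \<gamma> k" for k
    proof -
      have "hom_comp k ?f = (if \<gamma> k \<noteq> gr_class k 0 then hom_comp k (f k) else 0)"
        using fin by (simp add: hom_comp_sum hom_comp_hom_comp sum.delta)
      moreover have "gr_class k (hom_comp k (f k)) = gr_class k (f k)"
        using f(1)[of k]
        by (intro gr_class_cong') (auto simp: in_filt_prev_iff hom_comp_diff hom_comp_hom_comp free_filt_iff)
      ultimately show ?thesis using f(2)[of k] by (auto simp: symbol_def)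
    qed
    then have "symbol ?f = \<gamma>" by (rule ext)
    then show "\<gamma> \<in> range symbol" by (rule range_eqI[OF sym])
  next
    fix \<gamma> assume "\<gamma> \<in> range symbol"
    then obtain f where f: "\<gamma> = symbol f" by blast
    then show "\<gamma> \<in> {\<gamma>. (\<forall>k. \<gamma> k \<in> gr_class k ` free_filt k) \<and> finite {k. \<gamma> k \<noteq> gr_class k 0}}"
      using finite_symbol_support[of f] by (auto simp: symbol_def hom_comp_in_free_filt)
  qed
  finally show ?thesis .
qed

lemma mult_gr_alg: "monoid.mult (gr_alg U F) (symbol f) (symbol g) = symbol (f * g)"
proof
  fix k
  have product: "hom_comp i f * hom_comp (k - i) g \<in> free_filt k" if "i \<le> k" for i
    using free_filt_mult[OF hom_comp_in_free_filt hom_comp_in_free_filt, of i f "k - i" g] that by simp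
  have "monoid.mult (gr_alg U F) (symbol f) (symbol g) k =
      finprod (gr_comp U F k)
       (\<lambda>i. rcoset_mult U (filt_prev U F k) (symbol f i) (symbol g (k - i))) {..k}"
    by (simp add: gr_alg_def)
  also have "\<dots> = finprod (gr_comp U F k) (\<lambda>i. gr_class k (hom_comp i f * hom_comp (k - i) g)) {..k}"
  proof -
    interpret comm_group "gr_comp U F k" by (rule comm_group_gr_comp)
    show ?thesis
    proof (rule finprod_cong')
      show "(\<lambda>i. gr_class k (hom_comp i f * hom_comp (k - i) g)) \<in> {..k} \<rightarrow> carrier (gr_comp U F k)"
        unfolding carrier_gr_comp using product by blast
      show "rcoset_mult U (filt_prev U F k) (symbol f i) (symbol g (k - i)) =
          gr_class k (hom_comp i f * hom_comp (k - i) g)" if "i \<in> {..k}" for i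
        unfolding symbol_def using that by (intro rcoset_mult_gr_class hom_comp_in_free_filt) simp
    qed simp
  qed
  also have "\<dots> = gr_class k (\<Sum>i\<le>k. hom_comp i f * hom_comp (k - i) g)"
    using product by (intro finprod_gr_comp) simp_all
  also have "\<dots> = symbol (f * g) k"
    by (simp add: symbol_def hom_comp_mult)
  finally show "monoid.mult (gr_alg U F) (symbol f) (symbol g) k = symbol (f * g) k" .
qed

lemma add_gr_alg: "add (gr_alg U F) (symbol f) (symbol g) = symbol (f + g)"
  by (rule ext) (simp add: gr_alg_def symbol_def mult_gr_comp hom_comp_add)

lemma one_gr_alg: "one (gr_alg U F) = symbol 1"
proof
  fix k
  have "hom_comp k (1 :: ('x, 'k) ncpoly) = (if k = 0 then 1 else 0)" by (rule hom_comp_1)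
  then show "one (gr_alg U F) k = symbol 1 k"
    by (auto simp: gr_alg_def symbol_def free.one_quot[OF ideal_J] coset_filt_prev gr_class_0)
qed

lemma smult_gr_alg: "smult (gr_alg U F) c (symbol f) = symbol (Poly_Mapping.single 0 c * f)"
  by (rule ext) (simp add: gr_alg_def symbol_def smult_gr_class hom_comp_scalar)

lemma gr_part_eq: "gr_part U F k = symbol ` free_part k"
proof (intro equalityI subsetI)
  fix \<gamma> assume "\<gamma> \<in> gr_part U F k"
  then obtain f where f: "\<gamma> = symbol f" "\<And>i. i \<noteq> k \<Longrightarrow> symbol f i = gr_class i 0"
    by (auto simp: gr_part_def carrier_gr_alg gr_class_0)
  have "symbol f i = symbol (hom_comp k f) i" for i
    using f(2)[of i] by (cases "i = k") (simp_all add: symbol_def hom_comp_hom_comp)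
  then have "\<gamma> = symbol (hom_comp k f)"
    unfolding f(1) by (rule ext)
  then show "\<gamma> \<in> symbol ` free_part k" using hom_comp_in_free_part by blast
next
  fix \<gamma> assume "\<gamma> \<in> symbol ` free_part k"
  then obtain f where f: "f \<in> free_part k" "\<gamma> = symbol f" by blast
  have "symbol f i = filt_prev U F i" if "i \<noteq> k" for i
    unfolding symbol_def hom_comp_free_part[OF f(1)] using that gr_class_0 by simp
  then show "\<gamma> \<in> gr_part U F k"
    unfolding gr_part_def carrier_gr_alg f(2) by blast
qed

end

section \<open>A linear relation in finite dimension\<close>

text \<open>
  The relation \<open>R\<close> stands for a surjective linear map from \<open>V\<close> to \<open>V/I\<close> that kills \<open>L\<close>. Then
  \<open>dim V - dim L \<ge> dim V - dim I\<close>, and \<open>I \<subseteq> L\<close> forces equality. Stating it with a relation on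
  \<open>V\<close> avoids quotient spaces. The proof picks images of the part of a basis of \<open>V\<close> that lies
  outside a basis of \<open>L\<close>; together with a basis of \<open>I\<close> they span \<open>V\<close>.
\<close>

lemma (in vector_space) linear_relation_collapse:
  assumes V: "subspace V" "finite B" "V \<subseteq> span B"
    and I: "subspace I" "I \<subseteq> L" and L: "L \<subseteq> V"
    and add: "\<And>u v u' v'. R u v \<Longrightarrow> R u' v' \<Longrightarrow> R (u + u') (v + v')"
    and scale: "\<And>c u v. R u v \<Longrightarrow> R (scale c u) (scale c v)"
    and total: "\<And>u. u \<in> V \<Longrightarrow> \<exists>v\<in>V. R u v"
    and onto: "\<And>v. v \<in> V \<Longrightarrow> \<exists>u\<in>V. R u v"
    and collapse: "\<And>u v. R u v \<Longrightarrow> u \<in> L \<Longrightarrow> v \<in> I"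
  shows "L \<subseteq> I"
proof -
  obtain BI where BI: "BI \<subseteq> I" "independent BI" "I \<subseteq> span BI"
    using maximal_independent_subset by blast
  obtain BL where BL: "BI \<subseteq> BL" "BL \<subseteq> L" "independent BL" "L \<subseteq> span BL"
    using maximal_independent_subset_extend[of BI L] BI I by blast
  obtain BV where BV: "BL \<subseteq> BV" "BV \<subseteq> V" "independent BV" "V \<subseteq> span BV"
    using maximal_independent_subset_extend[of BL V] BL L by blast
  have fin: "finite BV"
    using independent_span_bound[OF V(2) BV(3)] BV(2) V(3) by blast
  have "\<forall>b\<in>V. \<exists>v. v \<in> V \<and> R b v" using total by blast
  then obtain t where t: "\<And>b. b \<in> V \<Longrightarrow> t b \<in> V" "\<And>b. b \<in> V \<Longrightarrow> R b (t b)" by metis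
  define S where "S = t ` (BV - BL) \<union> BI"
  have R0: "R 0 0"
    using scale[OF t(2)[OF subspace_0[OF V(1)]], of 0] by simp
  have span_BV: "\<exists>v\<in>span S. R u v" if "u \<in> span BV" for u
    using that
  proof (induction rule: span_induct_alt)
    case base
    then show ?case using R0 span_zero by blast
  next
    case (step c b u)
    obtain v where v: "v \<in> span S" "R u v" using step by blast
    have b: "b \<in> V" using step BV by blast
    have "t b \<in> span S"
    proof (cases "b \<in> BL")
      case True
      then have "t b \<in> I" using collapse t(2)[OF b] BL by blast
      then show ?thesis using BI(3) span_mono[of BI S] by (auto simp: S_def)
    next
      case False
      then show ?thesis using step by (intro span_base) (simp add: S_def)
    qed
    then have "scale c (t b) + v \<in> span S" using v(1) by (intro span_add span_scale)
    moreover have "R (scale c b + u) (scale c (t b) + v)" using t(2)[OF b] v(2) by (intro add scale)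
    ultimately show ?case by blast
  qed
  have "V \<subseteq> span S"
  proof
    fix v assume "v \<in> V"
    then obtain u where u: "u \<in> V" "R u v" using onto by blast
    then obtain v' where v': "v' \<in> span S" "R u v'" using span_BV BV(4) by blast
    \<comment> \<open>Two images of \<open>u\<close> differ by an image of \<open>0 \<in> L\<close>, that is, by an element of \<open>I\<close>.\<close>
    have "R (scale (- 1) u) (scale (- 1) v')" using v'(2) by (rule scale)
    then have "R (u + - u) (v + - v')" using u(2) by (intro add) simp_all
    moreover have "0 \<in> L" using subspace_0[OF I(1)] I(2) by blast
    ultimately have "v - v' \<in> I" using collapse by simp
    then have "v - v' \<in> span S" using BI(3) span_mono[of BI S] by (auto simp: S_def)
    then show "v \<in> span S" using span_add[OF _ v'(1), of "v - v'"] by simp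
  qed
  moreover have "finite S"
    using fin BL(1) BV(1) by (auto simp: S_def intro: finite_subset)
  ultimately have "card BV \<le> card S"
    using independent_span_bound[of S BV] BV by blast
  also have "card S \<le> card (BV - BL) + card BI"
    unfolding S_def using fin by (meson card_Un_le card_image_le add_right_mono finite_Diff order_trans)
  also have "card (BV - BL) = card BV - card BL"
    using fin BV(1) by (simp add: card_Diff_subset finite_subset)
  finally have "card BL \<le> card BI"
    using card_mono[OF fin BV(1)] by linarith
  then have "BI = BL"
    using BL(1) BV(1) fin by (intro card_seteq) (auto intro: finite_subset)
  then show ?thesis
    using BL(4) span_minimal[OF BI(1) I(1)] by blast
qed

interpretation free_vs: vector_space "\<lambda>c f. Poly_Mapping.single 0 c * (f :: ('x, 'k::field) ncpoly)"
  by standard (simp_all add: distrib_left distrib_right single_add mult_single flip: mult.assoc)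

lemma free_part_finite_span:
  "free_part k \<subseteq> free_vs.span ((\<lambda>w :: 'x list. Poly_Mapping.single w (1 :: 'k::field)) ` {w. length w = k})"
proof
  fix f :: "('x, 'k) ncpoly"
  assume "f \<in> free_part k"
  then have f: "f = hom_comp k f" by (simp add: free_part_iff)
  have "Poly_Mapping.single w c \<in>
      free_vs.span ((\<lambda>w :: 'x list. Poly_Mapping.single w (1 :: 'k)) ` {w. length w = k})"
    if "length w = k" for w c
    using free_vs.span_scale[OF free_vs.span_base[OF imageI[of w "{w. length w = k}" "\<lambda>w. Poly_Mapping.single w (1 :: 'k)"]], of c] that
    by (simp add: mult_single)
  then show "f \<in> free_vs.span ((\<lambda>w :: 'x list. Poly_Mapping.single w (1 :: 'k)) ` {w. length w = k})"
    by (subst f, subst hom_comp_def) (auto intro: free_vs.span_sum)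
qed

section \<open>The PBW property in terms of leading forms\<close>

context deformed_relations
begin

sublocale filtered_quotient J
  by (rule filtered_quotient.intro) (rule ideal_J)

abbreviation A where "A \<equiv> quot_alg free_alg I"
abbreviation clsA where "clsA \<equiv> a_r_coset free_alg I"

lemma PBW_deformation_alt:
  "PBW_deformation m r l \<longleftrightarrow>
    graded_alg_isomorphic (gr_alg U F) (gr_part U F) A (quot_family free_alg I free_part)"
  by (simp add: PBW_deformation_def pres_alg_def pres_filt_def pres_part_def Let_def)

text \<open>
  The isomorphism maps an element of \<open>gr(U)\<close> to its fibre under \<^const>\<open>symbol\<close>. Since the kernel of
  \<^const>\<open>symbol\<close> is \<open>I\<close>, the fibre is a coset of \<open>I\<close>.
\<close>

lemma leading_forms_imp_PBW:
  assumes leading: "\<And>k. leading_forms J k \<subseteq> I"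
  shows "PBW_deformation m r l"
proof -
  have eq_iff: "symbol f = symbol g \<longleftrightarrow> f - g \<in> I" for f g
  proof -
    have "f - g \<in> I" if "\<And>k. hom_comp k (f - g) \<in> I"
      using sum_hom_comp_eq[of "f - g"] free.ideal_sum[OF ideal_I] that by (metis order_refl)
    then show ?thesis
      unfolding symbol_eq_iff
      using leading hom_comp_in_I I_subset_leading_forms hom_comp_in_free_part by blast
  qed
  define \<phi> where "\<phi> \<gamma> = {f. symbol f = \<gamma>}" for \<gamma>
  have \<phi>: "\<phi> (symbol f) = clsA f" for f
    by (auto simp: \<phi>_def eq_iff free.coset_eq[OF ideal_I])
  have "\<phi> \<in> ring_iso (gr_alg U F) A"
  proof (rule ring_iso_memI)
    show "bij_betw \<phi> (carrier (gr_alg U F)) (carrier A)"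
      unfolding bij_betw_def carrier_gr_alg free.carrier_quot[OF ideal_I]
      by (auto intro!: inj_onI simp: \<phi> image_image eq_iff free.coset_eq_iff[OF ideal_I])
  qed (auto simp: carrier_gr_alg free.carrier_quot[OF ideal_I] mult_gr_alg add_gr_alg one_gr_alg \<phi>
      free.mult_quot[OF ideal_I] free.add_quot[OF ideal_I] free.one_quot[OF ideal_I])
  moreover have "\<phi> (smult (gr_alg U F) c x) = smult A c (\<phi> x)" if "x \<in> carrier (gr_alg U F)" for c x
    using that by (auto simp: carrier_gr_alg smult_gr_alg \<phi> free.smult_quot[OF ideal_I])
  moreover have "\<phi> ` gr_part U F k = quot_family free_alg I free_part k" for k
    by (simp add: gr_part_eq quot_family_def image_image \<phi>)
  ultimately show ?thesis
    unfolding PBW_deformation_alt graded_alg_isomorphic_def by blast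
qed

text \<open>
  The composition of \<^const>\<open>symbol\<close> with any graded isomorphism from \<open>gr(U)\<close> to \<open>A\<close> is a surjective
  linear map from \<open>T\<^sub>k\<close> to \<open>T\<^sub>k/I\<^sub>k\<close> that kills the leading forms of \<open>J\<close>. Finitely many letters
  make \<open>T\<^sub>k\<close> finite-dimensional, so the dimension count applies.
\<close>

lemma PBW_imp_leading_forms:
  assumes fin: "finite (UNIV :: 'x set)" and PBW: "PBW_deformation m r l"
  shows "leading_forms J k \<subseteq> I"
proof -
  obtain \<phi> where iso: "\<phi> \<in> ring_iso (gr_alg U F) A"
    and smult: "\<And>c x. x \<in> carrier (gr_alg U F) \<Longrightarrow> \<phi> (smult (gr_alg U F) c x) = smult A c (\<phi> x)"
    and part: "\<And>k. \<phi> ` gr_part U F k = quot_family free_alg I free_part k"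
    using PBW unfolding PBW_deformation_alt graded_alg_isomorphic_def by blast
  define R where "R u v \<longleftrightarrow> \<phi> (symbol u) = clsA v" for u v
  have add: "R (u + u') (v + v')" if "R u v" "R u' v'" for u v u' v'
    using that ring_hom_add[of \<phi> "gr_alg U F" A "symbol u" "symbol u'"] iso
    by (simp add: R_def ring_iso_def carrier_gr_alg add_gr_alg free.add_quot[OF ideal_I])
  have scale: "R (Poly_Mapping.single 0 c * u) (Poly_Mapping.single 0 c * v)" if "R u v" for c u v
    using that smult[of "symbol u" c]
    by (simp add: R_def carrier_gr_alg smult_gr_alg free.smult_quot[OF ideal_I])
  have image: "(\<lambda>u. \<phi> (symbol u)) ` free_part k = clsA ` free_part k"
    using part[of k] by (simp add: gr_part_eq quot_family_def image_image)
  have R0: "v \<in> I" if "R 0 v" for v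
  proof -
    \<comment> \<open>An additive map sends \<open>0\<close> to an idempotent of the additive group \<open>T/I\<close>, hence to \<open>0\<close>.\<close>
    have "R 0 (v + v)" using add[OF that that] by simp
    then have "clsA (v + v) = clsA v" using that by (simp add: R_def)
    then show ?thesis by (simp add: free.coset_eq_iff[OF ideal_I])
  qed
  have subspace: "free_vs.subspace (I \<inter> free_part k)" "free_vs.subspace (free_part k)"
    using free.ideal_0[OF ideal_I] free.ideal_add[OF ideal_I] free.ideal_mult_left[OF ideal_I]
    by (auto simp: free_vs.subspace_def free_part_iff hom_comp_add hom_comp_scalar)
  have "leading_forms J k \<subseteq> I \<inter> free_part k"
  proof (rule free_vs.linear_relation_collapse[where R = "\<lambda>u v. R u v \<and> v \<in> free_part k" and V = "free_part k"])
    show "free_part k \<subseteq> free_vs.span ((\<lambda>w :: 'x list. Poly_Mapping.single w (1 :: 'k)) ` {w. length w = k})"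
      by (rule free_part_finite_span)
    show "finite ((\<lambda>w :: 'x list. Poly_Mapping.single w (1 :: 'k)) ` {w. length w = k})"
      using finite_lists_length_eq[OF fin, of k] by simp
    show "I \<inter> free_part k \<subseteq> leading_forms J k" using I_subset_leading_forms by blast
    show "leading_forms J k \<subseteq> free_part k" by (auto simp: leading_forms_def)
    show "\<exists>v\<in>free_part k. R u v \<and> v \<in> free_part k" if "u \<in> free_part k" for u
    proof -
      have "\<phi> (symbol u) \<in> clsA ` free_part k" using that image by blast
      then show ?thesis by (auto simp: R_def)
    qed
    show "\<exists>u\<in>free_part k. R u v \<and> v \<in> free_part k" if "v \<in> free_part k" for v
    proof -
      have "clsA v \<in> (\<lambda>u. \<phi> (symbol u)) ` free_part k" using that image by blast
      then show ?thesis using that by (auto simp: R_def)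
    qed
    show "v \<in> I \<inter> free_part k" if "R u v \<and> v \<in> free_part k" "u \<in> leading_forms J k" for u v
    proof -
      have u: "u \<in> free_part k" using that(2) by (simp add: leading_forms_def)
      have "0 \<in> leading_forms J j" for j
        using I_subset_leading_forms[of 0 j] free.ideal_0[OF ideal_I] by (simp add: free_part_iff)
      then have "symbol u = symbol 0"
        using that(2) u by (simp add: symbol_eq_iff hom_comp_free_part)
      then show ?thesis using that(1) R0 by (simp add: R_def)
    qed
  qed (use subspace add scale in \<open>auto simp: free_part_iff hom_comp_add hom_comp_scalar\<close>)
  then show ?thesis by blast
qed

end

theorem theorem1p3:
  fixes r l :: "nat \<Rightarrow> ('x::finite, 'k::field) ncpoly" and m :: nat
  assumes "graded_relations m r"
    and "deformation_terms m r l"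
  shows "PBW_deformation m r l \<longleftrightarrow> regular_central_extension m r l"
proof -
  interpret deformed_relations m r l
    using assms by unfold_locales
  show ?thesis
    using regular_iff_leading_forms leading_forms_imp_PBW PBW_imp_leading_forms[OF finite_UNIV] by blast
qed

end
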